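(* Let $\varphi$ satisfy (i)–(vi) of the context, let $\Omega\subset\mathbb{R}^n$ be a domain, and for $h=1,\dots,n$ let $\mathscr{A}^h(x)=\{a^h_{ij}(x)\}_{i,j=1}^m$ be an $m\times m$ matrix with complex-valued entries in $L^1_{\rm loc}(\Omega)$. Assume $\Lambda_\infty^2=\sup_{t>0}\Lambda^2(t)<1$. Then the operator $Au=\sum_{h=1}^n\partial_h(\mathscr{A}^h(x)\partial_h u)$ is strict $L^\Phi$-dissipative if and only if there exists $\kappa'>0$ such that $$\mathrm{Re}\langle \mathscr{A}^h(x)\lambda,\lambda\rangle-\Lambda_\infty^2\,\mathrm{Re}\langle \mathscr{A}^h(x)\omega,\omega\rangle(\mathrm{Re}\langle\lambda,\omega\rangle)^2+\Lambda_\infty\,\mathrm{Re}\big(\langle \mathscr{A}^h(x)\omega,\lambda\rangle-\langle \mathscr{A}^h(x)\lambda,\omega\rangle\big)\mathrm{Re}\langle\lambda,\omega\rangle\ \geq\ \kappa'|\lambda|^2$$ for almost every $x\in\Omega$, for all $\lambda,\omega\in\mathbb{C}^m$ with $|\omega|=1$, and for every $h=1,\dots,n$ (no summation over $h$).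
   Context: Conditions on $\varphi:(0,+\infty)\to(0,+\infty)$: (i) $\varphi\in C^1((0,+\infty))$; (ii) $(s\varphi(s))'>0$ for all $s>0$; (iii) the range of $s\mapsto s\varphi(s)$ is $(0,+\infty)$; (iv) there are $s_0>0$, $C_1,C_2>0$ and a real $r>-1$ with $C_1s^r\le(s\varphi(s))'\le C_2s^r$ for $s\in(0,s_0)$, and if $r=0$ moreover the finite limit $\lim_{s\to0^+}\varphi(s)>0$ exists and $\lim_{s\to0^+}s\varphi'(s)=0$; (v) there is $s_1>s_0$ such that either $\varphi'(s)\ge0$ for all $s\ge s_1$ or $\varphi'(s)\le0$ for all $s\ge s_1$; (vi) $s\mapsto|s\varphi'(s)/\varphi(s)|$ is non-decreasing on $(0,+\infty)$. The function $\Lambda$ on $(0,+\infty)$ is defined by $\Lambda(s\sqrt{\varphi(s)})=-\dfrac{s\varphi'(s)}{s\varphi'(s)+2\varphi(s)}$, $s>0$. Under (i)–(vi), $\Lambda$ is monotone with constant sign and $\Lambda^2$ is non-decreasing; $\Lambda_\infty:=\lim_{t\to+\infty}\Lambda(t)$, so $\Lambda_\infty^2=\sup_{t>0}\Lambda^2(t)$. $\langle\cdot,\cdot\rangle$ is the standard Hermitian inner product on $\mathbb{C}^m$, $|\cdot|$ its norm; $C^1_0(\Omega)$ is the space of complex-valued $C^1$ functions with compact support in $\Omega$. Expressions such as $\varphi(|u|)u$ and $\sqrt{\varphi(|u|)}\,u$ are understood as $0$ where $u=0$. The operator $A$ is strict $L^\Phi$-dissipative if there is $\kappa>0$ such that $\mathrm{Re}\int_\Omega\sum_h\langle\mathscr{A}^h\partial_hu,\partial_h(\varphi(|u|)u)\rangle\,dx\ge\kappa\int_\Omega|\nabla(\sqrt{\varphi(|u|)}\,u)|^2dx$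 for all $u\in[C^1_0(\Omega)]^m$ such that $\varphi(|u|)u\in[C^1_0(\Omega)]^m$. *)

theory Defs
  imports "HOL-Analysis.Analysis"
begin

definition phi_conditions :: "(real \<Rightarrow> real) \<Rightarrow> bool" where
  "phi_conditions \<phi> \<longleftrightarrow>
     (\<forall>s>0. \<phi> s > 0) \<and>
     (\<forall>s>0. \<phi> differentiable (at s)) \<and> continuous_on {0<..} (deriv \<phi>) \<and>
     (\<forall>s>0. deriv (\<lambda>s. s * \<phi> s) s > 0) \<and>
     (\<lambda>s. s * \<phi> s) ` {0<..} = {0<..} \<and>
     (\<exists>s0>0.
        (\<exists>C1>0. \<exists>C2>0. \<exists>r>-1.
           (\<forall>s\<in>{0<..<s0}. C1 * s powr r \<le> deriv (\<lambda>s. s * \<phi> s) s \<and>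
                             deriv (\<lambda>s. s * \<phi> s) s \<le> C2 * s powr r) \<and>
           (r = 0 \<longrightarrow> (\<exists>L>0. (\<phi> \<longlongrightarrow> L) (at_right 0)) \<and>
                     ((\<lambda>s. s * deriv \<phi> s) \<longlongrightarrow> 0) (at_right 0))) \<and>
        (\<exists>s1>s0. (\<forall>s\<ge>s1. deriv \<phi> s \<ge> 0) \<or> (\<forall>s\<ge>s1. deriv \<phi> s \<le> 0))) \<and>
     mono_on {0<..} (\<lambda>s. \<bar>s * deriv \<phi> s / \<phi> s\<bar>)"

definition Lambda :: "(real \<Rightarrow> real) \<Rightarrow> real \<Rightarrow> real" where
  "Lambda \<phi> t =
     (let s = inv_into {0<..} (\<lambda>s. s * sqrt (\<phi> s)) t
      in - (s * deriv \<phi> s / (s * deriv \<phi> s + 2 * \<phi> s)))"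

text \<open>The map inverted above is injective on the positive half-line, so \<^const>\<open>Lambda\<close>
  satisfies its defining relation:\<close>

lemma Lambda_eq:
  assumes \<phi>: "phi_conditions \<phi>" and "s > 0"
  shows "Lambda \<phi> (s * sqrt (\<phi> s)) = - (s * deriv \<phi> s / (s * deriv \<phi> s + 2 * \<phi> s))"
proof -
  have pos: "\<phi> x > 0" and diff: "\<phi> differentiable (at x)"
    and dpos: "deriv (\<lambda>s. s * \<phi> s) x > 0" if "x > 0" for x
    using \<phi> that unfolding phi_conditions_def by blast+
  have deriv: "((\<lambda>s. s * \<phi> s) has_real_derivative deriv (\<lambda>s. s * \<phi> s) x) (at x)"
    if "x > 0" for x
    using differentiable_mult[OF differentiable_ident diff[OF that]]
    by (simp add: DERIV_deriv_iff_real_differentiable)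
  have less: "a * sqrt (\<phi> a) < b * sqrt (\<phi> b)" if "0 < a" "a < b" for a b
  proof -
    have "a * \<phi> a < b * \<phi> b"
      using \<open>a < b\<close>
    proof (rule DERIV_pos_imp_increasing)
      fix x assume "a \<le> x"
      then have "x > 0" using \<open>0 < a\<close> by linarith
      then show "\<exists>y. ((\<lambda>s. s * \<phi> s) has_real_derivative y) (at x) \<and> y > 0"
        using deriv dpos by blast
    qed
    then have "a * (a * \<phi> a) < b * (b * \<phi> b)"
      by (rule mult_strict_mono[OF \<open>a < b\<close>])
        (use that pos[of a] in \<open>simp_all add: less_imp_le\<close>)
    then have "sqrt (a * (a * \<phi> a)) < sqrt (b * (b * \<phi> b))"
      by simp
    then show ?thesis
      using that by (simp add: real_sqrt_mult flip: mult.assoc)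
  qed
  have "inj_on (\<lambda>s. s * sqrt (\<phi> s)) {0<..}"
    by (intro linorder_inj_onI) (auto dest: less)
  then have "inv_into {0<..} (\<lambda>s. s * sqrt (\<phi> s)) (s * sqrt (\<phi> s)) = s"
    using \<open>s > 0\<close> inv_into_f_f by fastforce
  then show ?thesis
    by (simp only: Lambda_def Let_def)
qed

definition Lambda_infty :: "(real \<Rightarrow> real) \<Rightarrow> real" where
  "Lambda_infty \<phi> = Lim at_top (Lambda \<phi>)"

definition herm_inner :: "complex ^ 'm \<Rightarrow> complex ^ 'm \<Rightarrow> complex" where
  "herm_inner x y = (\<Sum>i\<in>UNIV. x $ i * cnj (y $ i))"

definition partial_deriv :: "'n \<Rightarrow> (real ^ 'n \<Rightarrow> 'b::real_normed_vector) \<Rightarrow> real ^ 'n \<Rightarrow> 'b" where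
  "partial_deriv h f x = frechet_derivative f (at x) (axis h 1)"

text \<open>Functions on the open set \<^term>\<open>\<Omega>\<close> are represented by total functions whose values outside
  \<^term>\<open>\<Omega>\<close> are irrelevant.\<close>

definition C1_0 :: "(real ^ 'n) set \<Rightarrow> (real ^ 'n \<Rightarrow> complex) set" where
  "C1_0 \<Omega> = {f. (\<forall>x\<in>\<Omega>. f differentiable (at x)) \<and>
                (\<forall>h. continuous_on \<Omega> (partial_deriv h f)) \<and>
                compact (closure {x\<in>\<Omega>. f x \<noteq> 0}) \<and> closure {x\<in>\<Omega>. f x \<noteq> 0} \<subseteq> \<Omega>}"

definition C1_0_vec :: "(real ^ 'n) set \<Rightarrow> (real ^ 'n \<Rightarrow> complex ^ 'm) set" where
  "C1_0_vec \<Omega> = {u. \<forall>i. (\<lambda>x. u x $ i) \<in> C1_0 \<Omega>}"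

definition L1_loc :: "(real ^ 'n) set \<Rightarrow> (real ^ 'n \<Rightarrow> complex) set" where
  "L1_loc \<Omega> = {f. \<forall>K. compact K \<and> K \<subseteq> \<Omega> \<longrightarrow> set_integrable lebesgue K f}"

text \<open>Scalar multiplication yields \<open>0\<close> where \<^term>\<open>u x = 0\<close>, whatever the value \<open>\<phi> 0\<close>.
  For \<open>\<phi>\<close> satisfying \<^const>\<open>phi_conditions\<close> and admissible \<^term>\<open>u\<close>, the function
  \<open>\<lambda>x. sqrt (\<phi> (norm (u x))) *\<^sub>R u x\<close> is differentiable on \<open>\<Omega>\<close> also at the zeros of \<open>u\<close>,
  so its classical partial derivatives are meaningful: as \<open>s\<close> tends to 0, either \<open>\<phi> s\<close> has
  a finite limit, or it tends to infinity and the function is of smaller order than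
  \<open>\<lambda>x. \<phi> (norm (u x)) *\<^sub>R u x\<close>.\<close>

definition strict_dissipative ::
  "(real \<Rightarrow> real) \<Rightarrow> (real ^ 'n) set \<Rightarrow> ('n \<Rightarrow> real ^ 'n \<Rightarrow> complex ^ 'm ^ 'm) \<Rightarrow> bool" where
  "strict_dissipative \<phi> \<Omega> A \<longleftrightarrow>
     (\<exists>\<kappa>>0. \<forall>u. u \<in> C1_0_vec \<Omega> \<and> (\<lambda>x. \<phi> (norm (u x)) *\<^sub>R u x) \<in> C1_0_vec \<Omega> \<longrightarrow>
        Re (LINT x:\<Omega>|lebesgue. (\<Sum>h\<in>UNIV.
              herm_inner (A h x *v partial_deriv h u x)
                         (partial_deriv h (\<lambda>y. \<phi> (norm (u y)) *\<^sub>R u y) x)))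
        \<ge> \<kappa> * (LINT x:\<Omega>|lebesgue. (\<Sum>h\<in>UNIV.
              (norm (partial_deriv h (\<lambda>y. sqrt (\<phi> (norm (u y))) *\<^sub>R u y) x))\<^sup>2)))"

end

theory Submission
  imports Defs
begin

text \<open>
  Write \<open>v = \<surd>\<phi>(|u|) u\<close> and \<open>\<omega> = u / |u|\<close>. Pointwise, \<open>\<langle>A\<^sup>h \<partial>\<^sub>h u, \<partial>\<^sub>h(\<phi>(|u|)u)\<rangle>\<close> is the form of the theorem
  evaluated at \<open>\<xi> = \<partial>\<^sub>h v\<close>, with \<open>\<Lambda>(|v|)\<close> in place of \<open>\<Lambda>\<^sub>\<infinity>\<close>.

  Sufficiency: the choice \<open>\<omega> = \<i>\<xi> / |\<xi>|\<close> shows that each \<open>A\<^sup>h\<close> is coercive, so the form is concave in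
  \<open>\<Lambda>\<close>; the bound at \<open>0\<close> and at \<open>\<Lambda>\<^sub>\<infinity>\<close> gives the bound at every \<open>\<Lambda>(t)\<close>, which lies in between.

  Necessity: test with \<open>u = s \<omega> + N\<^sup>-\<^sup>1 \<psi> sin(N\<^sup>2 x\<^sub>h + \<theta>) \<zeta>\<close>, where \<open>s\<close> is a cut-off equal to a constant
  \<open>S\<close> on the support of \<open>\<psi>\<close>. The gradient is of size \<open>N\<close> and points in the direction \<open>\<zeta>\<close>, while
  \<open>u\<close> stays close to \<open>S \<omega>\<close>. Divided by \<open>N\<^sup>2\<close> and summed over the phases \<open>\<theta> = 0, \<pi>/2\<close>, the inequality
  tends to \<open>\<integral> \<psi>\<^sup>2 F \<ge> 0\<close>, where \<open>F\<close> is the form at \<open>\<Lambda>(S \<surd>\<phi>(S))\<close> minus \<open>\<kappa>|\<xi>|\<^sup>2\<close>, up to a positive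
  factor. Hence \<open>F \<ge> 0\<close> almost everywhere, simultaneously for a countable dense set of directions, and
  \<open>S \<rightarrow> \<infinity>\<close> concludes.
\<close>

subsection \<open>Consequences of the conditions on \<open>\<phi>\<close>\<close>

lemma tendsto_SUP_at_top:
  fixes f :: "real \<Rightarrow> real"
  assumes mono: "\<And>a b. 0 < a \<Longrightarrow> a \<le> b \<Longrightarrow> f a \<le> f b" and bd: "\<And>a. 0 < a \<Longrightarrow> f a \<le> M"
  shows "(f \<longlongrightarrow> (SUP x\<in>{0<..}. f x)) at_top"
    and "\<And>a. 0 < a \<Longrightarrow> f a \<le> (SUP x\<in>{0<..}. f x)"
proof -
  have bdd: "bdd_above (f ` {0<..})"
    using bd by (auto intro!: bdd_aboveI[where M=M])
  show le: "f a \<le> (SUP x\<in>{0<..}. f x)" if "0 < a" for a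
    using that bdd by (intro cSUP_upper) auto
  show "(f \<longlongrightarrow> (SUP x\<in>{0<..}. f x)) at_top"
  proof (rule increasing_tendsto)
    show "\<forall>\<^sub>F n in at_top. f n \<le> (SUP x\<in>{0<..}. f x)"
      using eventually_gt_at_top[of 0] by eventually_elim (rule le)
    fix x assume "x < (SUP x\<in>{0<..}. f x)"
    then obtain y where y: "y > 0" "x < f y"
      using less_cSUP_iff[OF _ bdd, of x] by auto
    show "\<forall>\<^sub>F n in at_top. x < f n"
      using eventually_ge_at_top[of y] by eventually_elim (use y mono in force)
  qed
qed

section \<open>Scalar functions of the radial variable s = |u|\<close>

locale phi_function =
  fixes \<phi> :: "real \<Rightarrow> real"
  assumes phi: "phi_conditions \<phi>"
begin

lemma pos: "s > 0 \<Longrightarrow> \<phi> s > 0"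
  using phi by (simp add: phi_conditions_def)

lemma DERIV_phi: "s > 0 \<Longrightarrow> (\<phi> has_real_derivative deriv \<phi> s) (at s)"
  using phi by (simp add: phi_conditions_def DERIV_deriv_iff_real_differentiable)

lemma continuous_deriv: "continuous_on {0<..} (deriv \<phi>)"
  using phi by (simp add: phi_conditions_def)

lemma continuous_phi: "continuous_on {0<..} \<phi>"
  by (meson DERIV_phi DERIV_isCont continuous_at_imp_continuous_on greaterThan_iff)

text \<open>For s = |u|, \<open>flux s\<close> is the length of \<phi>(|u|) u and
  \<open>amp s\<close> that of v.\<close>

definition flux :: "real \<Rightarrow> real" where "flux s = s * \<phi> s"

definition amp :: "real \<Rightarrow> real" where "amp s = s * sqrt (\<phi> s)"

text \<open>The derivative of log \<phi> with respect to log s; in terms of it the derivatives of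
  \<open>flux\<close>, \<open>amp\<close> and sqrt \<phi> all become multiples of \<phi> or sqrt
  \<phi>.\<close>

definition logder :: "real \<Rightarrow> real" where "logder s = s * deriv \<phi> s / \<phi> s"

text \<open>This is \<Lambda> read in the variable s instead of t = \<open>amp s\<close>, so that no
  inverse function enters the computations; \<open>Lambda_amp\<close> is the identification.\<close>

definition lam :: "real \<Rightarrow> real" where "lam s = - (logder s / (logder s + 2))"

lemma DERIV_flux: "s > 0 \<Longrightarrow> (flux has_real_derivative \<phi> s * (1 + logder s)) (at s)"
  unfolding flux_def[abs_def] logder_def
  by (rule derivative_eq_intros DERIV_phi refl | assumption)+
    (use pos[of s] in \<open>simp add: field_simps\<close>)

text \<open>The derivative of \<open>flux\<close> is \<phi> times 1 + \<open>logder\<close>, and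
  condition (ii) makes it positive. In particular the denominator \<open>logder s + 2\<close> is
  always greater than 1.\<close>

lemma logder_gt: assumes "s > 0" shows "logder s > -1"
proof -
  have "deriv flux s > 0"
    using phi assms by (simp add: phi_conditions_def flux_def[abs_def])
  then show ?thesis
    using DERIV_imp_deriv[OF DERIV_flux[OF assms]] pos[OF assms] by (simp add: zero_less_mult_iff)
qed

lemma DERIV_sqrt_phi:
  "s > 0 \<Longrightarrow> ((\<lambda>s. sqrt (\<phi> s)) has_real_derivative sqrt (\<phi> s) * logder s / (2 * s)) (at s)"
  by (rule DERIV_cong[OF DERIV_chain2[OF DERIV_real_sqrt DERIV_phi]])
    (use pos[of s] in \<open>auto simp: logder_def divide_simps\<close>)

lemma DERIV_amp: "s > 0 \<Longrightarrow> (amp has_real_derivative sqrt (\<phi> s) * (1 + logder s / 2)) (at s)"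
  unfolding amp_def[abs_def]
  by (rule derivative_eq_intros DERIV_sqrt_phi refl | assumption)+ (simp add: field_simps)

lemma continuous_logder: "continuous_on {0<..} logder"
  unfolding logder_def[abs_def]
  by (intro continuous_intros continuous_deriv continuous_phi) (use pos in force)

lemma abs_logder_mono: "0 < a \<Longrightarrow> a \<le> b \<Longrightarrow> \<bar>logder a\<bar> \<le> \<bar>logder b\<bar>"
  using phi unfolding phi_conditions_def logder_def
  by (elim conjE) (erule mono_onD, auto)

text \<open>A change of sign between a and b would produce a zero c between them. Since
  |\<open>logder\<close>| is non-decreasing, \<open>logder\<close> would then vanish at the smaller
  of a and b as well, where it is nonzero.\<close>

lemma logder_sign: "(\<forall>s>0. 0 \<le> logder s) \<or> (\<forall>s>0. logder s \<le> 0)"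
proof (rule ccontr)
  assume "\<not> ?thesis"
  then obtain a b where ab: "a > 0" "b > 0" "logder a < 0" "logder b > 0"
    by (auto simp: not_le)
  have cont: "continuous_on {min a b..max a b} logder"
    by (rule continuous_on_subset[OF continuous_logder]) (use ab in auto)
  have "connected (logder ` {min a b..max a b})"
    by (intro connected_continuous_image cont) simp
  moreover have "logder a \<in> logder ` {min a b..max a b}" "logder b \<in> logder ` {min a b..max a b}"
    by auto
  ultimately have "0 \<in> logder ` {min a b..max a b}"
    using ab unfolding connected_iff_interval by (meson less_imp_le)
  then obtain c where c: "min a b \<le> c" "logder c = 0" by auto
  have "\<bar>logder (min a b)\<bar> \<le> \<bar>logder c\<bar>"
    using c ab by (intro abs_logder_mono) auto
  then show False using c ab by (auto simp: min_def split: if_splits)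
qed

lemma flux_strict_mono: "0 < a \<Longrightarrow> a < b \<Longrightarrow> flux a < flux b"
  by (rule DERIV_pos_imp_increasing, assumption)
    (meson DERIV_flux logder_gt pos add_pos_pos mult_pos_pos less_le_trans real_0_less_add_iff
      neg_less_iff_less minus_less_iff)

lemma amp_strict_mono: assumes "0 < a" "a < b" shows "amp a < amp b"
  using assms(2)
proof (rule DERIV_pos_imp_increasing)
  fix x assume "a \<le> x"
  then have x: "x > 0" using assms by simp
  have "1 + logder x / 2 > 0" using logder_gt[OF x] by simp
  then have "sqrt (\<phi> x) * (1 + logder x / 2) > 0" using pos[OF x] by simp
  then show "\<exists>y. (amp has_real_derivative y) (at x) \<and> y > 0"
    using DERIV_amp[OF x] by blast
qed

lemma flux_range: "flux ` {0<..} = {0<..}"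
  using phi unfolding phi_conditions_def flux_def[abs_def] by blast

lemma amp_pos: "s > 0 \<Longrightarrow> amp s > 0"
  by (simp add: amp_def pos)

lemma flux_pos: "s > 0 \<Longrightarrow> flux s > 0"
  by (simp add: flux_def pos)

lemma amp_square: "s > 0 \<Longrightarrow> (amp s)\<^sup>2 = s * flux s"
  using pos[of s] by (simp add: amp_def flux_def power2_eq_square algebra_simps)

text \<open>Condition (iii) speaks of \<open>flux\<close> only, and \<open>amp_square\<close>
  transfers it. If \<open>flux a = y\<close>, then the square of \<open>amp\<close> is at most the
  square of y at the smaller of a and y, and at least that at the larger one; the intermediate value
  theorem gives s.\<close>

lemma amp_surj: assumes "y > 0" obtains s where "s > 0" "amp s = y"
proof -
  obtain a where a: "a > 0" "flux a = y"
    using assms flux_range by (metis greaterThan_iff imageE)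
  have fm: "flux x \<le> flux z" if "0 < x" "x \<le> z" for x z
    using flux_strict_mono[OF that(1)] that(2) by (cases "x = z") (auto simp: less_le)
  have cont: "continuous_on {min a y..max a y} amp"
    by (meson DERIV_amp DERIV_isCont a assms atLeastAtMost_iff
        continuous_at_imp_continuous_on less_le_trans min_less_iff_conj)
  have "(amp (min a y))\<^sup>2 \<le> y\<^sup>2" "y\<^sup>2 \<le> (amp (max a y))\<^sup>2"
    using a assms fm[of a y] fm[of y a] amp_square[of a] amp_square[of y]
    by (auto simp: power2_eq_square min_def max_def)
  then have "amp (min a y) \<le> y" "y \<le> amp (max a y)"
    using power2_le_imp_le[of "amp (min a y)" y] power2_le_imp_le[of y "amp (max a y)"]
      amp_pos[of "max a y"] assms a by (auto simp: less_max_iff_disj)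
  then obtain s where "min a y \<le> s" "amp s = y"
    using IVT'[OF _ _ _ cont] by (auto simp: min_def max_def split: if_splits)
  then show ?thesis using that[of s] a assms by (auto simp: min_def split: if_splits)
qed

lemma filterlim_amp: "filterlim amp at_top at_top"
  unfolding filterlim_at_top
proof
  fix Z :: real
  obtain s where s: "s > 0" "amp s = max Z 1"
    by (metis amp_surj less_max_iff_disj zero_less_one)
  show "\<forall>\<^sub>F x in at_top. Z \<le> amp x"
    using eventually_gt_at_top[of s]
    by eventually_elim (use s amp_strict_mono in fastforce)
qed

lemma Lambda_amp: "s > 0 \<Longrightarrow> Lambda \<phi> (amp s) = lam s"
  unfolding amp_def using Lambda_eq[OF phi] pos[of s] by (simp add: lam_def logder_def field_simps)

lemma abs_lam: "s > 0 \<Longrightarrow> \<bar>lam s\<bar> = \<bar>logder s\<bar> / (logder s + 2)"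
  using logder_gt[of s] by (simp add: lam_def abs_div)

lemma abs_lam_mono: assumes "0 < a" "a \<le> b" shows "\<bar>lam a\<bar> \<le> \<bar>lam b\<bar>"
proof -
  have b: "b > 0" using assms by simp
  \<comment> \<open>As \<open>logder\<close> keeps its sign, the products |\<open>logder a\<close>|
    \<open>logder b\<close> and |\<open>logder b\<close>| \<open>logder a\<close> agree, and only 2
    |\<open>logder a\<close>| \<le> 2 |\<open>logder b\<close>| is left to prove.\<close>
  have "\<bar>logder a\<bar> * (logder b + 2) \<le> \<bar>logder b\<bar> * (logder a + 2)"
    using logder_sign abs_logder_mono[OF assms] assms(1) b
    by (auto simp: algebra_simps)
  then show ?thesis
    using logder_gt[OF assms(1)] logder_gt[OF b] assms b by (simp add: abs_lam divide_simps)
qed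

lemma abs_lam_less: "s > 0 \<Longrightarrow> \<bar>lam s\<bar> < 1"
  using logder_gt[of s] by (simp add: abs_lam divide_simps)

lemma lam_sign: obtains e :: real where "e = 1 \<or> e = -1" "\<And>s. s > 0 \<Longrightarrow> \<bar>lam s\<bar> = e * lam s"
proof -
  from logder_sign show ?thesis
  proof
    assume "\<forall>s>0. 0 \<le> logder s"
    then show ?thesis using that[of "-1"] by (simp add: lam_def)
  next
    assume "\<forall>s>0. logder s \<le> 0"
    moreover have "logder s + 2 > 0" if "s > 0" for s using logder_gt[OF that] by simp
    ultimately have "lam s \<ge> 0" if "s > 0" for s
      unfolding lam_def using that by (meson divide_nonpos_pos neg_0_le_iff_le)
    then show ?thesis using that[of 1] by simp
  qed
qed

text \<open>Up to a global sign e, \<Lambda> is |\<Lambda>|, which is non-decreasing and bounded, so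
  the limit exists and equals e times the supremum. Every value of \<Lambda> therefore has the sign
  of the limit and at most its modulus; the resulting fraction \<theta> is the weight for the
  concavity argument in l.\<close>

lemma lam_infty:
  shows lam_tendsto: "(lam \<longlongrightarrow> Lambda_infty \<phi>) at_top"
    and lam_fraction: "\<And>s. s > 0 \<Longrightarrow> \<exists>\<theta>. 0 \<le> \<theta> \<and> \<theta> \<le> 1 \<and> lam s = \<theta> * Lambda_infty \<phi>"
proof -
  obtain e where e: "e = 1 \<or> e = -1" "\<And>s. s > 0 \<Longrightarrow> \<bar>lam s\<bar> = e * lam s"
    using lam_sign by metis
  \<comment> \<open>On positive arguments f is |\<Lambda>|. It is written with the factor e so that
    a second multiplication by e recovers \<Lambda> and its limit.\<close>
  define f where "f = (\<lambda>t. e * Lambda \<phi> t)"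
  have f_amp: "f (amp s) = \<bar>lam s\<bar>" if "s > 0" for s
    using that by (simp add: f_def Lambda_amp e)
  have mono: "f a \<le> f b" if ab: "0 < a" "a \<le> b" for a b
  proof -
    obtain x y where xy: "x > 0" "a = amp x" "y > 0" "b = amp y"
      by (metis amp_surj ab less_le_trans)
    then have "x \<le> y" using ab amp_strict_mono[of y x] by force
    then show ?thesis using xy by (simp add: f_amp abs_lam_mono)
  qed
  have bd: "f a \<le> 1" if "0 < a" for a
    by (metis amp_surj[OF that] f_amp abs_lam_less less_imp_le)
  define l where "l = (SUP x\<in>{0<..}. f x)"
  have lim: "(f \<longlongrightarrow> l) at_top" and le: "\<And>a. a > 0 \<Longrightarrow> f a \<le> l"
    unfolding l_def using tendsto_SUP_at_top[OF mono bd] by auto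
  have ee: "e * (e * x) = x" for x using e(1) by auto
  have "((\<lambda>t. e * f t) \<longlongrightarrow> e * l) at_top" by (intro tendsto_intros lim)
  then have "(Lambda \<phi> \<longlongrightarrow> e * l) at_top" by (simp add: f_def ee)
  moreover from this have L: "Lambda_infty \<phi> = e * l"
    unfolding Lambda_infty_def by (intro tendsto_Lim) simp_all
  ultimately have "((\<lambda>s. Lambda \<phi> (amp s)) \<longlongrightarrow> Lambda_infty \<phi>) at_top"
    using filterlim_compose[OF _ filterlim_amp] by simp
  then show "(lam \<longlongrightarrow> Lambda_infty \<phi>) at_top"
    by (rule Lim_transform_eventually) (use eventually_gt_at_top[of 0] in eventually_elim, rule Lambda_amp)
  fix s :: real assume s: "s > 0"
  have sl: "e * lam s = \<bar>lam s\<bar>" "\<bar>lam s\<bar> \<le> l"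
    using s e le[of "amp s"] by (simp_all add: f_amp amp_pos)
  show "\<exists>\<theta>. 0 \<le> \<theta> \<and> \<theta> \<le> 1 \<and> lam s = \<theta> * Lambda_infty \<phi>"
  \<comment> \<open>If l = 0, then \<open>lam s = 0\<close>, and division by zero yields the
    fraction 0, which is still a correct witness.\<close>
  proof (intro exI[of _ "\<bar>lam s\<bar> / l"] conjI)
    show "0 \<le> \<bar>lam s\<bar> / l" "\<bar>lam s\<bar> / l \<le> 1" using sl by (auto simp: divide_simps)
    show "lam s = \<bar>lam s\<bar> / l * Lambda_infty \<phi>"
      using sl ee[of "lam s"] by (cases "l = 0") (auto simp: L mult.commute)
  qed
qed

text \<open>The constant sign of \<open>logder\<close> makes \<phi> monotone, so it has a one-sided
  limit at 0, finite or infinite. These are the two cases in the analysis of the zeros of u.\<close>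

lemma phi_limit_0:
  "(\<exists>L\<ge>0. (\<phi> \<longlongrightarrow> L) (at_right 0)) \<or> filterlim \<phi> at_top (at_right 0)"
proof -
  have d: "deriv \<phi> s = logder s * \<phi> s / s" if "s > 0" for s
    using that pos[OF that] by (simp add: logder_def)
  from logder_sign show ?thesis
  proof
    assume "\<forall>s>0. 0 \<le> logder s"
    then have mono: "\<phi> a \<le> \<phi> b" if "0 < a" "a \<le> b" for a b
      using that by (intro DERIV_nonneg_imp_nondecreasing[of a b \<phi>])
        (auto intro!: exI[of _ "deriv \<phi> _"] DERIV_phi simp: d pos less_imp_le)
    have bdd: "bdd_below (\<phi> ` {0<..})"
      using pos by (intro bdd_belowI[of _ 0]) (auto simp: less_imp_le)
    have "(\<phi> \<longlongrightarrow> (INF x\<in>{0<..}. \<phi> x)) (at_right 0)"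
    proof (rule decreasing_tendsto)
      show "\<forall>\<^sub>F n in at_right 0. (INF x\<in>{0<..}. \<phi> x) \<le> \<phi> n"
        using bdd by (auto simp: eventually_at_filter intro!: always_eventually cINF_lower)
      fix x assume "(INF x\<in>{0<..}. \<phi> x) < x"
      then obtain y where y: "y > 0" "\<phi> y < x"
        using cINF_less_iff[OF _ bdd, of x] by auto
      then show "\<forall>\<^sub>F n in at_right 0. \<phi> n < x"
        using mono unfolding eventually_at_right_field by (meson less_imp_le le_less_trans)
    qed
    moreover have "(INF x\<in>{0<..}. \<phi> x) \<ge> 0"
      using pos by (intro cINF_greatest) (auto simp: less_imp_le)
    ultimately show ?thesis by blast
  next
    assume "\<forall>s>0. logder s \<le> 0"
    then have mono: "\<phi> b \<le> \<phi> a" if "0 < a" "a \<le> b" for a b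
      using that by (intro DERIV_nonpos_imp_nonincreasing[of a b \<phi>])
        (auto intro!: exI[of _ "deriv \<phi> _"] DERIV_phi
          simp: d pos less_imp_le divide_nonpos_pos mult_nonpos_nonneg)
    show ?thesis
    proof (cases "bdd_above (\<phi> ` {0<..})")
      case True
      have "(\<phi> \<longlongrightarrow> (SUP x\<in>{0<..}. \<phi> x)) (at_right 0)"
      proof (rule increasing_tendsto)
        show "\<forall>\<^sub>F n in at_right 0. \<phi> n \<le> (SUP x\<in>{0<..}. \<phi> x)"
          using True by (auto simp: eventually_at_filter intro!: always_eventually cSUP_upper)
        fix x assume "x < (SUP x\<in>{0<..}. \<phi> x)"
        then obtain y where y: "y > 0" "x < \<phi> y"
          using less_cSUP_iff[OF _ True, of x] by auto
        then show "\<forall>\<^sub>F n in at_right 0. x < \<phi> n"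
          using mono unfolding eventually_at_right_field by (meson less_imp_le less_le_trans)
      qed
      moreover have "(SUP x\<in>{0<..}. \<phi> x) \<ge> 0"
        using pos[of 1] by (intro cSUP_upper2[OF True, of 1]) auto
      ultimately show ?thesis by blast
    next
      case False
      have "filterlim \<phi> at_top (at_right 0)"
        unfolding filterlim_at_top
      proof
        fix Z
        from False obtain y where "y > 0" "Z \<le> \<phi> y"
          unfolding bdd_above_def by (auto simp: not_le intro: less_imp_le)
        then show "\<forall>\<^sub>F x in at_right 0. Z \<le> \<phi> x"
          using mono unfolding eventually_at_right_field by (meson less_imp_le order_trans)
      qed
      then show ?thesis by blast
    qed
  qed
qed

end

subsection \<open>The algebraic form\<close>

text \<open>The derivative of \<open>y \<mapsto> g (norm y) *\<^sub>R y\<close>, where \<open>p s\<close> stands for \<open>s * g' s / g s\<close>.\<close>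

definition dradial :: "(real \<Rightarrow> real) \<Rightarrow> (real \<Rightarrow> real) \<Rightarrow> 'a::real_inner \<Rightarrow> 'a \<Rightarrow> 'a" where
  "dradial g p y d = g (norm y) *\<^sub>R (d + (p (norm y) * (sgn y \<bullet> d)) *\<^sub>R sgn y)"

lemma has_derivative_radial:
  fixes y :: "'a::real_inner"
  assumes "y \<noteq> 0" and "(g has_real_derivative g (norm y) * p (norm y) / norm y) (at (norm y))"
  shows "((\<lambda>y. g (norm y) *\<^sub>R y) has_derivative dradial g p y) (at y)"
proof -
  have "((\<lambda>y. g (norm y)) has_derivative (\<lambda>d. (d \<bullet> sgn y) * (g (norm y) * p (norm y) / norm y))) (at y)"
    using has_derivative_compose[OF has_derivative_norm[OF assms(1)]
        assms(2)[unfolded has_field_derivative_def]] by (simp add: mult.commute)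
  from has_derivative_scaleR[OF this has_derivative_ident] show ?thesis
    by (rule has_derivative_eq_rhs)
      (auto simp: dradial_def fun_eq_iff scaleR_add_right sgn_div_norm inner_commute divide_simps)
qed

lemma linear_dradial: "linear (dradial g p y)"
  unfolding dradial_def by (rule linearI) (simp_all add: algebra_simps)

lemma continuous_on_dradial:
  assumes "continuous_on {0<..} g" "continuous_on {0<..} p"
    and "continuous_on S f" "continuous_on S e" and "\<And>x. x \<in> S \<Longrightarrow> f x \<noteq> 0"
  shows "continuous_on S (\<lambda>x. dradial g p (f x) (e x))"
proof -
  have "continuous_on S (\<lambda>x. g (norm (f x)))" "continuous_on S (\<lambda>x. p (norm (f x)))"
    using assms by (auto intro!: continuous_on_compose2[of "{0<..}" g] continuous_on_compose2[of "{0<..}" p]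
        continuous_on_norm)
  then show ?thesis unfolding dradial_def using assms(3-5) by (intro continuous_intros) auto
qed

text \<open>Only real parts enter the problem, so the pointwise algebra can treat the complex space
  as a real Euclidean space.\<close>

lemma Re_herm_inner: "Re (herm_inner x y) = x \<bullet> y"
  by (simp add: herm_inner_def inner_vec_def inner_complex_def)

lemma matrix_vector_mult_scaleR_complex:
  fixes M :: "complex ^ 'm ^ 'n"
  shows "M *v (c *\<^sub>R x) = c *\<^sub>R (M *v x)"
  by (simp add: vec_eq_iff matrix_vector_mult_def scaleR_sum_right)

lemma dissipative_form_expand:
  fixes M :: "complex ^ 'm ^ 'm"
  shows "(M *v (\<xi> + (l * (\<xi> \<bullet> \<omega>)) *\<^sub>R \<omega>)) \<bullet> (\<xi> - (l * (\<xi> \<bullet> \<omega>)) *\<^sub>R \<omega>) =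
    (M *v \<xi>) \<bullet> \<xi> - l\<^sup>2 * ((M *v \<omega>) \<bullet> \<omega>) * (\<xi> \<bullet> \<omega>)\<^sup>2
    + l * ((M *v \<omega>) \<bullet> \<xi> - (M *v \<xi>) \<bullet> \<omega>) * (\<xi> \<bullet> \<omega>)"
  by (simp add: matrix_vector_right_distrib matrix_vector_mult_scaleR_complex
      inner_add_left inner_add_right inner_diff_right algebra_simps power2_eq_square)

text \<open>The factored shape is what the derivatives of u and of \<phi>(|u|) u produce;
  \<open>dissipative_form_expand\<close> turns it into the expression of the theorem.\<close>

definition dissipative_form :: "complex ^ 'm ^ 'm \<Rightarrow> real \<Rightarrow> complex ^ 'm \<Rightarrow> complex ^ 'm \<Rightarrow> real" where
  "dissipative_form M l \<xi> \<omega> =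
     (M *v (\<xi> + (l * (\<xi> \<bullet> \<omega>)) *\<^sub>R \<omega>)) \<bullet> (\<xi> - (l * (\<xi> \<bullet> \<omega>)) *\<^sub>R \<omega>)"

lemma dissipative_form_coercive:
  assumes "\<And>\<xi> \<omega>. norm \<omega> = 1 \<Longrightarrow> k * (norm \<xi>)\<^sup>2 \<le> dissipative_form M l \<xi> \<omega>"
  shows "k * (norm \<xi>)\<^sup>2 \<le> (M *v \<xi>) \<bullet> \<xi>"
proof (cases "\<xi> = 0")
  case False
  \<comment> \<open>\<open>\<i>\<xi>\<close> is orthogonal to \<open>\<xi>\<close> for the real inner product, which removes all terms with \<open>\<omega>\<close>.\<close>
  define \<omega> where "\<omega> = inverse (norm \<xi>) *\<^sub>R (\<chi> j. \<i> * \<xi> $ j)"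
  have "norm (\<chi> j. \<i> * \<xi> $ j) = norm \<xi>"
    by (simp add: norm_vec_def norm_mult)
  then have "norm \<omega> = 1" using False by (simp add: \<omega>_def)
  moreover have "\<xi> \<bullet> \<omega> = 0"
    by (simp add: \<omega>_def inner_vec_def inner_complex_def)
  ultimately show ?thesis using assms[of \<omega> \<xi>] by (simp add: dissipative_form_def)
qed simp

text \<open>As a function of \<open>l\<close>, the form is concave because \<open>M\<close> is coercive.\<close>

lemma dissipative_form_scale:
  assumes form: "\<And>\<xi> \<omega>. norm \<omega> = 1 \<Longrightarrow> k * (norm \<xi>)\<^sup>2 \<le> dissipative_form M l \<xi> \<omega>"
    and "k \<ge> 0" "norm \<omega> = 1" "0 \<le> \<theta>" "\<theta> \<le> 1"
  shows "k * (norm \<xi>)\<^sup>2 \<le> dissipative_form M (\<theta> * l) \<xi> \<omega>"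
proof -
  define c where "c = l\<^sup>2 * ((M *v \<omega>) \<bullet> \<omega>) * (\<xi> \<bullet> \<omega>)\<^sup>2"
  have "0 \<le> k * (norm \<omega>)\<^sup>2" using assms by simp
  then have "c \<ge> 0"
    unfolding c_def using order_trans[OF _ dissipative_form_coercive[OF form], of 0 \<omega>] by simp
  \<comment> \<open>The form is a quadratic polynomial in l, and \<theta>(1 - \<theta>)c is its
    excess at \<theta> l over the chord joining its values at 0 and l.\<close>
  then have "0 \<le> \<theta> * (1 - \<theta>) * c" using assms by simp
  also have "\<dots> = dissipative_form M (\<theta> * l) \<xi> \<omega> - ((1 - \<theta>) * ((M *v \<xi>) \<bullet> \<xi>) + \<theta> * dissipative_form M l \<xi> \<omega>)"
    unfolding c_def dissipative_form_def dissipative_form_expand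
    by (simp add: algebra_simps power2_eq_square)
  finally have "(1 - \<theta>) * ((M *v \<xi>) \<bullet> \<xi>) + \<theta> * dissipative_form M l \<xi> \<omega> \<le> dissipative_form M (\<theta> * l) \<xi> \<omega>"
    by simp
  moreover have "(1 - \<theta>) * (k * (norm \<xi>)\<^sup>2) \<le> (1 - \<theta>) * ((M *v \<xi>) \<bullet> \<xi>)"
    using assms dissipative_form_coercive[OF form] by (intro mult_left_mono) auto
  moreover have "\<theta> * (k * (norm \<xi>)\<^sup>2) \<le> \<theta> * dissipative_form M l \<xi> \<omega>"
    using assms by (intro mult_left_mono) auto
  ultimately show ?thesis by (simp add: algebra_simps)
qed

text \<open>Near a zero x, f is of size |y - x|, so (c - L) f is of smaller order as soon as c - L
  tends to 0. The limit of c is taken along the points with f nonzero because \<phi> is controlled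
  at positive arguments only.\<close>

lemma has_derivative_scaleR_at_zero:
  fixes f :: "'a::real_normed_vector \<Rightarrow> 'b::real_normed_vector"
  assumes f: "(f has_derivative f') (at x)" "f x = 0"
    and c: "(c \<longlongrightarrow> L) (at x within {y. f y \<noteq> 0})"
  shows "((\<lambda>y. c y *\<^sub>R f y) has_derivative (\<lambda>d. L *\<^sub>R f' d)) (at x)"
proof -
  have bl: "bounded_linear f'" using f(1) by (rule has_derivative_bounded_linear)
  then obtain B where B: "B > 0" "\<And>h. norm (f' h) \<le> norm h * B"
    using bounded_linear.pos_bounded by blast
  have "((\<lambda>y. (c y - L) *\<^sub>R f y) has_derivative (\<lambda>d. 0)) (at x)"
    unfolding has_derivative_at_alt
  proof (intro conjI allI impI bounded_linear_zero)
    fix e :: real assume e: "e > 0"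
    obtain d1 where d1: "d1 > 0"
      "\<And>y. norm (y - x) < d1 \<Longrightarrow> norm (f y - f x - f' (y - x)) \<le> 1 * norm (y - x)"
      using f(1) unfolding has_derivative_at_alt by (meson zero_less_one)
    have "e / (1 + B) > 0" using e B by simp
    then obtain d2 where d2: "d2 > 0"
      "\<And>y. f y \<noteq> 0 \<Longrightarrow> norm (y - x) < d2 \<Longrightarrow> \<bar>c y - L\<bar> < e / (1 + B)"
      using c f(2) unfolding Lim_within dist_norm
      by (metis (mono_tags, lifting) mem_Collect_eq norm_eq_zero real_norm_def right_minus_eq zero_less_norm_iff)
    show "\<exists>d>0. \<forall>y. norm (y - x) < d \<longrightarrow>
      norm ((c y - L) *\<^sub>R f y - (c x - L) *\<^sub>R f x - 0) \<le> e * norm (y - x)"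
    proof (intro exI[of _ "min d1 d2"] conjI allI impI)
      fix y assume y: "norm (y - x) < min d1 d2"
      have "norm (f y) \<le> norm (f y - f x - f' (y - x)) + norm (f' (y - x))"
        using norm_triangle_ineq[of "f y - f x - f' (y - x)" "f' (y - x)"] f(2) by simp
      also have "\<dots> \<le> (1 + B) * norm (y - x)"
        using d1(2)[of y] y B(2)[of "y - x"] by (simp add: algebra_simps)
      finally have 1: "norm (f y) \<le> (1 + B) * norm (y - x)" .
      have "\<bar>c y - L\<bar> * norm (f y) \<le> (e / (1 + B)) * ((1 + B) * norm (y - x))"
      proof (cases "f y = 0")
        case False
        then show ?thesis using d2(2)[of y] y 1 e B by (intro mult_mono) auto
      qed (use e B in simp)
      then show "norm ((c y - L) *\<^sub>R f y - (c x - L) *\<^sub>R f x - 0) \<le> e * norm (y - x)"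
        using f(2) B by simp
    qed (use d1 d2 in simp)
  qed
  from has_derivative_add[OF this has_derivative_scaleR_right[OF f(1), of L]]
  show ?thesis by (simp add: algebra_simps)
qed

section \<open>Pointwise inequalities between the derivatives of u, \<phi>(|u|) u and v\<close>

context phi_function
begin

definition dflux :: "'a::real_inner \<Rightarrow> 'a \<Rightarrow> 'a" where
  "dflux = dradial \<phi> logder"

text \<open>Half of \<open>logder\<close> appears because it is the logarithmic derivative of sqrt
  \<phi> with respect to log s.\<close>

definition damp :: "'a::real_inner \<Rightarrow> 'a \<Rightarrow> 'a" where
  "damp = dradial (\<lambda>s. sqrt (\<phi> s)) (\<lambda>s. logder s / 2)"

lemma has_derivative_flux:
  "y \<noteq> 0 \<Longrightarrow> ((\<lambda>y::'a::real_inner. \<phi> (norm y) *\<^sub>R y) has_derivative dflux y) (at y)"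
  unfolding dflux_def
  by (rule has_derivative_radial, assumption)
    (rule DERIV_cong[OF DERIV_phi], use pos[of "norm y"] in \<open>simp_all add: logder_def\<close>)

lemma has_derivative_amp:
  "y \<noteq> 0 \<Longrightarrow> ((\<lambda>y::'a::real_inner. sqrt (\<phi> (norm y)) *\<^sub>R y) has_derivative damp y) (at y)"
  unfolding damp_def
  by (rule has_derivative_radial, assumption)
    (rule DERIV_cong[OF DERIV_sqrt_phi], simp_all)

text \<open>Put q = \<open>logder\<close>, l = \<open>lam\<close> and \<omega> =
  \<open>sgn Y\<close>. From 1 + l = 2 / (q + 2) the correction q (\<omega> \<bullet> d) equals -2 l
  (\<xi> \<bullet> \<omega>). The derivative \<open>dflux\<close> adds all of it along \<omega>,
  turning the coefficient l into -l, while \<open>damp\<close> adds half of it and cancels that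
  coefficient.\<close>

lemma form_at_substitution:
  fixes M :: "complex ^ 'm ^ 'm"
  assumes Y: "Y \<noteq> 0"
    and d: "d = \<xi> + (lam (norm Y) * (\<xi> \<bullet> sgn Y)) *\<^sub>R sgn Y"
  shows "(M *v d) \<bullet> dflux Y d = \<phi> (norm Y) * dissipative_form M (lam (norm Y)) \<xi> (sgn Y)"
    and "damp Y d = sqrt (\<phi> (norm Y)) *\<^sub>R \<xi>"
proof -
  define s q l r where "s = norm Y" and "q = logder s" and "l = lam s" and "r = \<xi> \<bullet> sgn Y"
  have s: "s > 0" using Y by (simp add: s_def)
  have q: "q + 2 > 0" using logder_gt[OF s] by (simp add: q_def)
  have l: "l = - (q / (q + 2))" by (simp add: l_def q_def lam_def)
  have "sgn Y \<bullet> sgn Y = 1" using Y by (simp add: dot_square_norm norm_sgn)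
  then have "sgn Y \<bullet> d = r * (1 + l)"
    by (simp add: d inner_add_right inner_commute r_def l_def s_def algebra_simps)
  moreover have "1 + l = 2 / (q + 2)" using q by (simp add: l divide_simps)
  ultimately have *: "q * (sgn Y \<bullet> d) = -2 * l * r"
    by (simp add: l)
  have "dflux Y d = \<phi> s *\<^sub>R (d + (q * (sgn Y \<bullet> d)) *\<^sub>R sgn Y)"
    by (simp add: dflux_def dradial_def s_def q_def)
  also have "\<dots> = \<phi> s *\<^sub>R (\<xi> - (l * r) *\<^sub>R sgn Y)"
    unfolding * by (simp add: d l_def r_def s_def algebra_simps flip: scaleR_add_left)
  finally show "(M *v d) \<bullet> dflux Y d = \<phi> (norm Y) * dissipative_form M (lam (norm Y)) \<xi> (sgn Y)"
    by (simp add: dissipative_form_def d l_def r_def s_def)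
  have "damp Y d = sqrt (\<phi> s) *\<^sub>R (d + ((q * (sgn Y \<bullet> d)) / 2) *\<^sub>R sgn Y)"
    by (simp add: damp_def dradial_def s_def q_def)
  then show "damp Y d = sqrt (\<phi> (norm Y)) *\<^sub>R \<xi>"
    unfolding * by (simp add: d l_def r_def s_def algebra_simps)
qed

text \<open>The pointwise half of sufficiency: the bound at the limit value of \<Lambda> is carried
  to the value at |Y| by concavity, then read back through the substitution.\<close>

lemma form_lower_bound:
  fixes M :: "complex ^ 'm ^ 'm"
  assumes form: "\<And>\<xi> \<omega>. norm \<omega> = 1 \<Longrightarrow> k * (norm \<xi>)\<^sup>2 \<le> dissipative_form M (Lambda_infty \<phi>) \<xi> \<omega>"
    and "k \<ge> 0" "Y \<noteq> 0"
  shows "k * (norm (damp Y d))\<^sup>2 \<le> (M *v d) \<bullet> dflux Y d"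
proof -
  define s q \<omega> r where "s = norm Y" and "q = logder s" and "\<omega> = sgn Y" and "r = d \<bullet> \<omega>"
  have s: "s > 0" using assms by (simp add: s_def)
  have q: "q + 2 > 0" using logder_gt[OF s] by (simp add: q_def)
  \<comment> \<open>This is \<open>damp Y d\<close> divided by sqrt (\<phi> s), which inverts the
    substitution of \<open>form_at_substitution\<close>.\<close>
  define \<xi> where "\<xi> = d + (q / 2 * r) *\<^sub>R \<omega>"
  have w: "\<omega> \<bullet> \<omega> = 1" "norm \<omega> = 1"
    using assms by (simp_all add: \<omega>_def dot_square_norm norm_sgn)
  have "\<xi> \<bullet> \<omega> = r * ((q + 2) / 2)"
    by (simp add: \<xi>_def inner_add_left w r_def algebra_simps)
  moreover have "lam s * (r * ((q + 2) / 2)) = - (q / 2 * r)"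
    using q by (simp add: lam_def flip: q_def)
  ultimately have "lam s * (\<xi> \<bullet> \<omega>) = - (q / 2 * r)" by (simp only:)
  then have d: "d = \<xi> + (lam (norm Y) * (\<xi> \<bullet> sgn Y)) *\<^sub>R sgn Y"
    by (simp add: \<xi>_def \<omega>_def s_def)
  obtain \<theta> where \<theta>: "0 \<le> \<theta>" "\<theta> \<le> 1" "lam s = \<theta> * Lambda_infty \<phi>"
    using lam_fraction[OF s] by blast
  have "k * (norm \<xi>)\<^sup>2 \<le> dissipative_form M (lam s) \<xi> \<omega>"
    unfolding \<theta>(3) by (rule dissipative_form_scale[OF form]) (use assms w \<theta> in auto)
  then have "\<phi> s * (k * (norm \<xi>)\<^sup>2) \<le> \<phi> s * dissipative_form M (lam s) \<xi> \<omega>"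
    using pos[OF s] by simp
  then show ?thesis
    using form_at_substitution(1)[OF assms(3) d, of M] form_at_substitution(2)[OF assms(3) d] pos[OF s]
    by (simp add: s_def \<omega>_def power_mult_distrib algebra_simps)
qed

text \<open>The pointwise half of necessity: along Y = s \<omega> the direction \<open>sgn Y\<close>
  stays \<omega>, the positive factor \<phi> s cancels, and \<open>lam s\<close> tends to
  \<open>Lambda_infty\<close> as s grows. The form is polynomial in l, so the inequality passes to
  the limit.\<close>

lemma form_limit:
  fixes M :: "complex ^ 'm ^ 'm"
  assumes bound: "\<And>Y d. Y \<noteq> 0 \<Longrightarrow> k * (norm (damp Y d))\<^sup>2 \<le> (M *v d) \<bullet> dflux Y d"
    and w: "norm \<omega> = 1"
  shows "k * (norm \<xi>)\<^sup>2 \<le> dissipative_form M (Lambda_infty \<phi>) \<xi> \<omega>"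
proof -
  have "k * (norm \<xi>)\<^sup>2 \<le> dissipative_form M (lam s) \<xi> \<omega>" if s: "s > 0" for s
  proof -
    have Y: "s *\<^sub>R \<omega> \<noteq> 0" "norm (s *\<^sub>R \<omega>) = s" "sgn (s *\<^sub>R \<omega>) = \<omega>"
      using s w by (auto simp: sgn_div_norm)
    obtain d where d: "d = \<xi> + (lam (norm (s *\<^sub>R \<omega>)) * (\<xi> \<bullet> sgn (s *\<^sub>R \<omega>))) *\<^sub>R sgn (s *\<^sub>R \<omega>)"
      by blast
    have "k * (norm (sqrt (\<phi> s) *\<^sub>R \<xi>))\<^sup>2 \<le> \<phi> s * dissipative_form M (lam s) \<xi> \<omega>"
      using bound[OF Y(1), of d]
      unfolding form_at_substitution[OF Y(1) d] unfolding Y(2,3) .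
    then have "\<phi> s * (k * (norm \<xi>)\<^sup>2) \<le> \<phi> s * dissipative_form M (lam s) \<xi> \<omega>"
      using pos[OF s] by (simp add: power_mult_distrib algebra_simps)
    then show ?thesis using pos[OF s] by simp
  qed
  then have "\<forall>\<^sub>F s in at_top. k * (norm \<xi>)\<^sup>2 \<le> dissipative_form M (lam s) \<xi> \<omega>"
    by (rule eventually_mono[OF eventually_gt_at_top[of 0]])
  moreover have "((\<lambda>s. dissipative_form M (lam s) \<xi> \<omega>) \<longlongrightarrow> dissipative_form M (Lambda_infty \<phi>) \<xi> \<omega>) at_top"
    unfolding dissipative_form_def dissipative_form_expand
    by (intro tendsto_intros lam_tendsto)
  ultimately show ?thesis
    by (intro tendsto_lowerbound) auto
qed

text \<open>If \<phi> has a finite limit L at 0, the derivatives of v and \<phi>(|u|) u at the zero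
  are sqrt L and L times that of u, and the claim is L times coercivity. If \<phi> tends to
  infinity, the roles change: \<phi>(|u|) u is the given differentiable function, u and v arise from
  it with coefficients 1/\<phi> and 1/sqrt \<phi> that tend to 0, so both their derivatives
  vanish.\<close>

lemma derivative_at_zero:
  fixes u :: "'a::real_normed_vector \<Rightarrow> complex ^ 'm"
  assumes u: "u differentiable (at x)" "u x = 0"
    and w: "(\<lambda>y. \<phi> (norm (u y)) *\<^sub>R u y) differentiable (at x)"
    and M: "\<And>\<xi>. k * (norm \<xi>)\<^sup>2 \<le> (M *v \<xi>) \<bullet> \<xi>"
  shows "k * (norm (frechet_derivative (\<lambda>y. sqrt (\<phi> (norm (u y))) *\<^sub>R u y) (at x) e))\<^sup>2
    \<le> (M *v frechet_derivative u (at x) e) \<bullet>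
       frechet_derivative (\<lambda>y. \<phi> (norm (u y)) *\<^sub>R u y) (at x) e"
proof -
  obtain u' where u': "(u has_derivative u') (at x)" using u by (auto simp: differentiable_def)
  obtain w' where w': "((\<lambda>y. \<phi> (norm (u y)) *\<^sub>R u y) has_derivative w') (at x)"
    using w by (auto simp: differentiable_def)
  have "(u \<longlongrightarrow> 0) (at x within {y. u y \<noteq> 0})"
    using differentiable_imp_continuous_within[OF u(1)] u(2)
    by (metis continuous_at_imp_continuous_at_within continuous_within)
  then have lim: "filterlim (\<lambda>y. norm (u y)) (at_right 0) (at x within {y. u y \<noteq> 0})"
    by (auto simp: filterlim_at tendsto_norm_zero eventually_at_filter)
  from phi_limit_0 show ?thesis
  proof
    assume "\<exists>L\<ge>0. (\<phi> \<longlongrightarrow> L) (at_right 0)"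
    then obtain L where L: "L \<ge> 0" "(\<phi> \<longlongrightarrow> L) (at_right 0)" by blast
    note c = filterlim_compose[OF L(2) lim]
    have "w' = (\<lambda>d. L *\<^sub>R u' d)"
      using has_derivative_unique[OF w' has_derivative_scaleR_at_zero[OF u' u(2) c]] .
    moreover note has_derivative_scaleR_at_zero[OF u' u(2) tendsto_real_sqrt[OF c]]
    moreover have "L * (k * (norm (u' e))\<^sup>2) \<le> L * ((M *v u' e) \<bullet> u' e)"
      using L M by (intro mult_left_mono) auto
    ultimately show ?thesis
      using L(1) u' w' by (simp add: frechet_derivative_at[symmetric] power_mult_distrib algebra_simps)
  next
    assume inf: "filterlim \<phi> at_top (at_right 0)"
    have nz: "{y. \<phi> (norm (u y)) *\<^sub>R u y \<noteq> 0} = {y. u y \<noteq> 0}"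
      using pos by (auto simp: less_le)
    have inf': "filterlim (\<lambda>y. \<phi> (norm (u y))) at_top (at x within {y. u y \<noteq> 0})"
      by (rule filterlim_compose[OF inf lim])
    have c1: "((\<lambda>y. inverse (\<phi> (norm (u y)))) \<longlongrightarrow> 0) (at x within {y. \<phi> (norm (u y)) *\<^sub>R u y \<noteq> 0})"
      unfolding nz by (rule tendsto_inverse_0_at_top[OF inf'])
    have c2: "((\<lambda>y. inverse (sqrt (\<phi> (norm (u y))))) \<longlongrightarrow> 0) (at x within {y. \<phi> (norm (u y)) *\<^sub>R u y \<noteq> 0})"
      unfolding nz by (rule tendsto_inverse_0_at_top filterlim_compose[OF sqrt_at_top] inf')+
    have p: "\<phi> (norm (u y)) > 0" if "u y \<noteq> 0" for y using pos that by simp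
    have "(\<lambda>y. inverse (\<phi> (norm (u y))) *\<^sub>R (\<phi> (norm (u y)) *\<^sub>R u y)) = u"
    proof
      fix y show "inverse (\<phi> (norm (u y))) *\<^sub>R (\<phi> (norm (u y)) *\<^sub>R u y) = u y"
        using p[of y] by (cases "u y = 0") simp_all
    qed
    then have "(u has_derivative (\<lambda>d. 0)) (at x)"
      using has_derivative_scaleR_at_zero[OF w' _ c1] u(2) by simp
    moreover have "inverse (sqrt (\<phi> (norm (u y)))) *\<^sub>R (\<phi> (norm (u y)) *\<^sub>R u y) = sqrt (\<phi> (norm (u y))) *\<^sub>R u y" for y
      using p[of y] by (cases "u y = 0") (simp_all add: divide_simps)
    then have "((\<lambda>y. sqrt (\<phi> (norm (u y))) *\<^sub>R u y) has_derivative (\<lambda>d. 0 *\<^sub>R w' d)) (at x)"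
      using has_derivative_scaleR_at_zero[OF w' _ c2] u(2) by (simp only: scaleR_zero_right)
    ultimately show ?thesis
      by (simp add: frechet_derivative_at[symmetric] matrix_vector_mult_0_right)
  qed
qed

end

subsection \<open>Sufficiency\<close>

lemma bounded_linear_axis: "bounded_linear (axis i :: 'b::real_normed_vector \<Rightarrow> 'b ^ 'n)"
proof (rule bounded_linear_intro[of _ 1])
  show "norm (axis i x :: 'b ^ 'n) \<le> norm x * 1" for x
    by (simp add: norm_vec_def L2_set_def axis_def if_distrib[of norm] if_distrib[of "\<lambda>x. x\<^sup>2"] cong: if_cong)
qed (auto simp: axis_def vec_eq_iff)

lemma vec_eq_sum_axis: "v = (\<Sum>i\<in>UNIV. axis i (v $ i))"
  for v :: "'b::real_normed_vector ^ 'n"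
  by (simp add: vec_eq_iff axis_def sum.delta')

lemma has_derivative_vec:
  fixes f :: "'a::real_normed_vector \<Rightarrow> 'b::real_normed_vector ^ 'n"
  assumes "\<And>i. ((\<lambda>x. f x $ i) has_derivative f' i) (at x)"
  shows "(f has_derivative (\<lambda>d. \<chi> i. f' i d)) (at x)"
proof -
  have "((\<lambda>x. \<Sum>i\<in>UNIV. axis i (f x $ i)) has_derivative (\<lambda>d. \<Sum>i\<in>UNIV. axis i (f' i d))) (at x)"
    by (intro has_derivative_sum bounded_linear.has_derivative[OF bounded_linear_axis] assms)
  moreover have "(\<Sum>i\<in>UNIV. axis i (f' i d)) = (\<chi> i. f' i d)" for d
    using vec_eq_sum_axis[of "\<chi> i. f' i d"] by simp
  ultimately show ?thesis by (simp flip: vec_eq_sum_axis)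
qed

lemma partial_deriv_nth:
  fixes u :: "real ^ 'n \<Rightarrow> 'b::real_normed_vector ^ 'm"
  assumes "u differentiable (at x)"
  shows "(\<lambda>x. u x $ i) differentiable (at x)"
    and "partial_deriv h (\<lambda>x. u x $ i) x = partial_deriv h u x $ i"
proof -
  have "((\<lambda>x. u x $ i) has_derivative (\<lambda>d. frechet_derivative u (at x) d $ i)) (at x)"
    by (intro bounded_linear.has_derivative[OF bounded_linear_vec_nth])
      (use assms frechet_derivative_works in blast)
  then show "(\<lambda>x. u x $ i) differentiable (at x)"
    and "partial_deriv h (\<lambda>x. u x $ i) x = partial_deriv h u x $ i"
    by (auto simp: partial_deriv_def differentiable_def frechet_derivative_at[symmetric])
qed

lemma partial_deriv_eq:
  "(f has_derivative f') (at x) \<Longrightarrow> partial_deriv h f x = f' (axis h 1)"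
  by (simp add: partial_deriv_def frechet_derivative_at[symmetric])

lemma partial_deriv_cong:
  assumes "open S" "x \<in> S" "\<And>y. y \<in> S \<Longrightarrow> f y = g y" "f differentiable (at x)"
  shows "partial_deriv h f x = partial_deriv h g x"
  unfolding partial_deriv_def
  using frechet_derivative_transform_within_open[OF assms(4,1,2,3)] by simp

text \<open>Trades the componentwise conditions with closed supports for conditions on the whole
  vector function and one compact set outside which it vanishes, the form in which supports are used
  below.\<close>

lemma C1_0_vec_iff:
  fixes u :: "real ^ 'n \<Rightarrow> complex ^ 'm"
  assumes "open \<Omega>"
  shows "u \<in> C1_0_vec \<Omega> \<longleftrightarrow>
    (\<forall>x\<in>\<Omega>. u differentiable (at x)) \<and> (\<forall>h. continuous_on \<Omega> (partial_deriv h u)) \<and>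
    (\<exists>K. compact K \<and> K \<subseteq> \<Omega> \<and> (\<forall>x\<in>\<Omega> - K. u x = 0))"
proof (intro iffI conjI ballI allI; (elim conjE exE)?)
  assume u: "u \<in> C1_0_vec \<Omega>"
  show diff: "u differentiable (at x)" if x: "x \<in> \<Omega>" for x
  proof -
    have "\<forall>i. \<exists>f'. ((\<lambda>x. u x $ i) has_derivative f') (at x)"
      using u x by (auto simp: C1_0_vec_def C1_0_def differentiable_def)
    then obtain f' where "\<And>i. ((\<lambda>x. u x $ i) has_derivative f' i) (at x)" by metis
    from has_derivative_vec[OF this] show ?thesis by (auto simp: differentiable_def)
  qed
  show "continuous_on \<Omega> (partial_deriv h u)" for h
  proof -
    have "continuous_on \<Omega> (\<lambda>x. \<chi> i. partial_deriv h (\<lambda>x. u x $ i) x)"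
      using u by (intro continuous_on_vec_lambda) (simp add: C1_0_vec_def C1_0_def)
    then show ?thesis
      by (rule continuous_on_eq) (simp add: vec_eq_iff partial_deriv_nth diff)
  qed
  show "\<exists>K. compact K \<and> K \<subseteq> \<Omega> \<and> (\<forall>x\<in>\<Omega> - K. u x = 0)"
  proof (intro exI[of _ "\<Union>i. closure {x\<in>\<Omega>. u x $ i \<noteq> 0}"] conjI ballI)
    show "compact (\<Union>i. closure {x\<in>\<Omega>. u x $ i \<noteq> 0})"
      using u by (intro compact_UN) (auto simp: C1_0_vec_def C1_0_def)
    show "(\<Union>i. closure {x\<in>\<Omega>. u x $ i \<noteq> 0}) \<subseteq> \<Omega>"
      using u by (auto simp: C1_0_vec_def C1_0_def)
    fix x assume x: "x \<in> \<Omega> - (\<Union>i. closure {x\<in>\<Omega>. u x $ i \<noteq> 0})"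
    have "u x $ i = 0" for i
      using closure_subset[of "{x\<in>\<Omega>. u x $ i \<noteq> 0}"] x by blast
    then show "u x = 0" by (simp add: vec_eq_iff)
  qed
next
  fix K
  assume diff: "\<forall>x\<in>\<Omega>. u differentiable (at x)" and cont: "\<forall>h. continuous_on \<Omega> (partial_deriv h u)"
    and K: "compact K" "K \<subseteq> \<Omega>" "\<forall>x\<in>\<Omega> - K. u x = 0"
  have "(\<lambda>x. u x $ i) \<in> C1_0 \<Omega>" for i
  proof -
    have "continuous_on \<Omega> (partial_deriv h (\<lambda>x. u x $ i))" for h
      by (rule continuous_on_eq[of _ "\<lambda>x. partial_deriv h u x $ i"])
        (use cont diff in \<open>auto intro: continuous_on_component simp: partial_deriv_nth\<close>)
    moreover have sub: "closure {x\<in>\<Omega>. u x $ i \<noteq> 0} \<subseteq> K"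
      using K by (intro closure_minimal compact_imp_closed) force+
    moreover have "compact (closure {x\<in>\<Omega>. u x $ i \<noteq> 0})"
      using sub K(1)
      unfolding compact_eq_bounded_closed by (blast intro: bounded_subset)
    ultimately show ?thesis
      using K(2) diff by (auto simp: C1_0_def partial_deriv_nth)
  qed
  then show "u \<in> C1_0_vec \<Omega>" by (simp add: C1_0_vec_def)
qed

lemma partial_deriv_eq_0:
  assumes "open S" "x \<in> S" "\<And>y. y \<in> S \<Longrightarrow> u y = 0"
  shows "partial_deriv h u x = 0"
proof -
  have "((\<lambda>_. 0) has_derivative (\<lambda>_. 0)) (at x)" by simp
  then have "(u has_derivative (\<lambda>_. 0)) (at x)"
    by (rule has_derivative_transform_within_open[OF _ assms(1,2)]) (simp add: assms(3))
  then show ?thesis by (simp add: partial_deriv_eq)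
qed

lemma set_integrable_L1_loc_times_continuous:
  fixes g :: "real ^ 'n \<Rightarrow> complex"
  assumes a: "a \<in> L1_loc \<Omega>" and K: "compact K" "K \<subseteq> \<Omega>"
    and g: "continuous_on K g" "\<And>x. x \<in> \<Omega> - K \<Longrightarrow> g x = 0"
  shows "set_integrable lebesgue \<Omega> (\<lambda>x. a x * g x)"
proof -
  have aK: "integrable lebesgue (\<lambda>x. indicator K x *\<^sub>R a x)"
    using a K by (simp add: L1_loc_def set_integrable_def)
  have "bounded (g ` K)" using compact_continuous_image[OF g(1) K(1)] by (rule compact_imp_bounded)
  then obtain B where B: "B > 0" "\<And>x. x \<in> K \<Longrightarrow> norm (g x) \<le> B" by (auto simp: bounded_pos)
  have "K \<in> sets borel" using K by (simp add: compact_imp_closed)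
  then have "(\<lambda>x. indicator K x *\<^sub>R g x) \<in> borel_measurable borel"
    using g(1) by (rule borel_measurable_continuous_on_indicator)
  then have gm: "(\<lambda>x. indicator K x *\<^sub>R g x) \<in> borel_measurable lebesgue"
    by (simp add: measurable_completion)
  have "integrable lebesgue (\<lambda>x. (indicator K x *\<^sub>R a x) * (indicator K x *\<^sub>R g x))"
  proof (rule Bochner_Integration.integrable_bound[OF integrable_mult_right[OF integrable_norm[OF aK], of B]])
    show "(\<lambda>x. (indicator K x *\<^sub>R a x) * (indicator K x *\<^sub>R g x)) \<in> borel_measurable lebesgue"
      using borel_measurable_integrable[OF aK] gm by (rule borel_measurable_times)
    show "AE x in lebesgue. norm ((indicator K x *\<^sub>R a x) * (indicator K x *\<^sub>R g x))
      \<le> norm (B * norm (indicator K x *\<^sub>R a x))"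
      using B by (intro always_eventually allI)
        (auto simp: indicator_def norm_mult abs_mult mult.commute[of B] intro!: mult_left_mono)
  qed
  moreover have "indicator \<Omega> x *\<^sub>R (a x * g x) = (indicator K x *\<^sub>R a x) * (indicator K x *\<^sub>R g x)" for x
    using g(2)[of x] K by (auto simp: indicator_def)
  ultimately show ?thesis by (simp only: set_integrable_def)
qed

lemma set_integrable_herm_inner:
  fixes A :: "real ^ 'n \<Rightarrow> complex ^ 'm ^ 'm" and p r :: "real ^ 'n \<Rightarrow> complex ^ 'm"
  assumes "\<And>i j. (\<lambda>x. A x $ i $ j) \<in> L1_loc \<Omega>" and K: "compact K" "K \<subseteq> \<Omega>"
    and "continuous_on K p" "continuous_on K r" "\<And>x. x \<in> \<Omega> - K \<Longrightarrow> p x = 0"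
  shows "set_integrable lebesgue \<Omega> (\<lambda>x. herm_inner (A x *v p x) (r x))"
proof -
  have "set_integrable lebesgue \<Omega> (\<lambda>x. A x $ i $ j * (p x $ j * cnj (r x $ i)))" for i j
    using assms by (intro set_integrable_L1_loc_times_continuous[OF assms(1) K] continuous_intros) auto
  then have "set_integrable lebesgue \<Omega> (\<lambda>x. \<Sum>i\<in>UNIV. \<Sum>j\<in>UNIV. A x $ i $ j * (p x $ j * cnj (r x $ i)))"
    unfolding set_integrable_def scaleR_sum_right by (intro Bochner_Integration.integrable_sum)
  then show ?thesis
    by (simp add: herm_inner_def matrix_vector_mult_def sum_distrib_right mult.assoc)
qed

lemma set_integrable_dissipation:
  fixes \<Omega> :: "(real ^ 'n) set" and A :: "'n \<Rightarrow> real ^ 'n \<Rightarrow> complex ^ 'm ^ 'm"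
  assumes "open \<Omega>" and A: "\<And>h i j. (\<lambda>x. A h x $ i $ j) \<in> L1_loc \<Omega>"
    and u: "u \<in> C1_0_vec \<Omega>" and w: "w \<in> C1_0_vec \<Omega>"
  shows "set_integrable lebesgue \<Omega> (\<lambda>x. \<Sum>h\<in>UNIV. herm_inner (A h x *v partial_deriv h u x) (partial_deriv h w x))"
proof -
  obtain K where K: "compact K" "K \<subseteq> \<Omega>" "\<forall>x\<in>\<Omega> - K. u x = 0"
    using u unfolding C1_0_vec_iff[OF assms(1)] by blast
  have "open (\<Omega> - K)" using assms(1) K by (simp add: open_Diff compact_imp_closed)
  then have z: "partial_deriv h u x = 0" if "x \<in> \<Omega> - K" for h x
    by (rule partial_deriv_eq_0[OF _ that]) (use K(3) in blast)
  have c: "continuous_on K (partial_deriv h u)" "continuous_on K (partial_deriv h w)" for h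
    using u w K(2) unfolding C1_0_vec_iff[OF assms(1)] by (meson continuous_on_subset)+
  have "set_integrable lebesgue \<Omega> (\<lambda>x. herm_inner (A h x *v partial_deriv h u x) (partial_deriv h w x))" for h
    by (rule set_integrable_herm_inner[OF A K(1,2) c z])
  then show ?thesis
    unfolding set_integrable_def scaleR_sum_right by (rule Bochner_Integration.integrable_sum)
qed

text \<open>The inequality holds pointwise almost everywhere with the same constant k: by the chain
  rule where u is nonzero, by \<open>derivative_at_zero\<close> where u vanishes. It is then
  integrated.\<close>

lemma (in phi_function) sufficiency:
  fixes \<Omega> :: "(real ^ 'n) set" and A :: "'n \<Rightarrow> real ^ 'n \<Rightarrow> complex ^ 'm ^ 'm"
  assumes "open \<Omega>" and A: "\<And>h i j. (\<lambda>x. A h x $ i $ j) \<in> L1_loc \<Omega>" and "k > 0"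
    and form: "AE x\<in>\<Omega> in lebesgue. \<forall>\<xi> \<omega>. norm \<omega> = 1 \<longrightarrow> (\<forall>h.
      k * (norm \<xi>)\<^sup>2 \<le> dissipative_form (A h x) (Lambda_infty \<phi>) \<xi> \<omega>)"
  shows "strict_dissipative \<phi> \<Omega> A"
  unfolding strict_dissipative_def
proof (intro exI[of _ k] conjI allI impI)
  fix u :: "real ^ 'n \<Rightarrow> complex ^ 'm"
  define w where "w = (\<lambda>x. \<phi> (norm (u x)) *\<^sub>R u x)"
  define v where "v = (\<lambda>x. sqrt (\<phi> (norm (u x))) *\<^sub>R u x)"
  assume "u \<in> C1_0_vec \<Omega> \<and> (\<lambda>x. \<phi> (norm (u x)) *\<^sub>R u x) \<in> C1_0_vec \<Omega>"
  then have u: "u \<in> C1_0_vec \<Omega>" and w: "w \<in> C1_0_vec \<Omega>" by (simp_all add: w_def)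
  have udiff: "u differentiable (at x)" and wdiff: "w differentiable (at x)" if "x \<in> \<Omega>" for x
    using u w that unfolding C1_0_vec_iff[OF assms(1)] by blast+
  have pw: "k * (norm (partial_deriv h v x))\<^sup>2 \<le> (M *v partial_deriv h u x) \<bullet> partial_deriv h w x"
    if x: "x \<in> \<Omega>" and M: "\<And>\<xi> \<omega>. norm \<omega> = 1 \<Longrightarrow> k * (norm \<xi>)\<^sup>2 \<le> dissipative_form M (Lambda_infty \<phi>) \<xi> \<omega>"
    for x h and M :: "complex ^ 'm ^ 'm"
  proof (cases "u x = 0")
    case True
    show ?thesis
      using derivative_at_zero[OF udiff[OF x] True wdiff[OF x, unfolded w_def] dissipative_form_coercive[OF M]]
      by (simp add: partial_deriv_def v_def w_def)
  next
    case False
    obtain u' where u': "(u has_derivative u') (at x)"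
      using udiff[OF x] by (auto simp: differentiable_def)
    have "(w has_derivative (\<lambda>d. dflux (u x) (u' d))) (at x)"
      unfolding w_def by (rule has_derivative_compose[OF u' has_derivative_flux[OF False]])
    moreover have "(v has_derivative (\<lambda>d. damp (u x) (u' d))) (at x)"
      unfolding v_def by (rule has_derivative_compose[OF u' has_derivative_amp[OF False]])
    ultimately show ?thesis
      using form_lower_bound[OF M _ False, of "u' (axis h 1)"] u' assms(3)
      by (simp add: partial_deriv_eq)
  qed
  define f where "f = (\<lambda>x. \<Sum>h\<in>UNIV. herm_inner (A h x *v partial_deriv h u x) (partial_deriv h w x))"
  define g where "g = (\<lambda>x. \<Sum>h\<in>UNIV. (norm (partial_deriv h v x))\<^sup>2)"
  have f: "integrable lebesgue (\<lambda>x. indicator \<Omega> x *\<^sub>R f x)"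
    unfolding f_def using set_integrable_dissipation[OF assms(1) A u w] by (simp add: set_integrable_def)
  have AE: "AE x in lebesgue. indicator \<Omega> x * (k * g x) \<le> Re (indicator \<Omega> x *\<^sub>R f x)"
    using form
  proof eventually_elim
    case (elim x)
    then show ?case
      using pw[of x] by (cases "x \<in> \<Omega>")
        (auto simp: f_def g_def Re_sum Re_herm_inner sum_distrib_left intro!: sum_mono)
  qed
  have "k * (LINT x:\<Omega>|lebesgue. g x) \<le> (\<integral>x. Re (indicator \<Omega> x *\<^sub>R f x) \<partial>lebesgue)"
  proof (cases "set_integrable lebesgue \<Omega> g")
    case True
    then have "integrable lebesgue (\<lambda>x. indicator \<Omega> x * (k * g x))"
      using integrable_mult_right[of k lebesgue "\<lambda>x. indicator \<Omega> x *\<^sub>R g x"]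
      by (simp add: set_integrable_def algebra_simps)
    from integral_mono_AE[OF this integrable_Re[OF f] AE] show ?thesis
      by (simp add: set_lebesgue_integral_def mult.left_commute)
  next
    \<comment> \<open>The integral of a non-integrable function is 0 by convention, so here only the
      nonnegativity of the right-hand side has to be shown, which the pointwise bound also
      provides.\<close>
    case False
    then have "(LINT x:\<Omega>|lebesgue. g x) = 0"
      by (simp add: set_lebesgue_integral_def set_integrable_def not_integrable_integral_eq)
    moreover have "AE x in lebesgue. 0 \<le> Re (indicator \<Omega> x *\<^sub>R f x)"
      using AE
    proof eventually_elim
      case (elim x)
      moreover have "0 \<le> indicator \<Omega> x * (k * g x)"
        using assms(3) by (simp add: g_def sum_nonneg)
      ultimately show ?case by linarith
    qed
    then have "0 \<le> (\<integral>x. Re (indicator \<Omega> x *\<^sub>R f x) \<partial>lebesgue)"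
      by (rule integral_nonneg_AE)
    ultimately show ?thesis by simp
  qed
  also have "\<dots> = Re (LINT x:\<Omega>|lebesgue. f x)"
    unfolding set_lebesgue_integral_def using f by (rule integral_Re)
  finally show "k * (LINT x:\<Omega>|lebesgue. \<Sum>h\<in>UNIV.
      (norm (partial_deriv h (\<lambda>y. sqrt (\<phi> (norm (u y))) *\<^sub>R u y) x))\<^sup>2)
    \<le> Re (LINT x:\<Omega>|lebesgue. \<Sum>h\<in>UNIV. herm_inner (A h x *v partial_deriv h u x)
      (partial_deriv h (\<lambda>y. \<phi> (norm (u y)) *\<^sub>R u y) x))"
    by (simp add: f_def g_def v_def w_def)
qed (rule assms)

subsection \<open>Cut-off functions\<close>

definition C1_on :: "(real ^ 'n) set \<Rightarrow> (real ^ 'n \<Rightarrow> 'b::real_normed_vector) \<Rightarrow> bool" where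
  "C1_on S f \<longleftrightarrow> (\<forall>x\<in>S. f differentiable (at x)) \<and> (\<forall>h. continuous_on S (partial_deriv h f))"

lemma C1_onI:
  assumes "\<And>x. x \<in> S \<Longrightarrow> (f has_derivative f' x) (at x)"
    and "\<And>h. continuous_on S (\<lambda>x. f' x (axis h 1))"
  shows "C1_on S f"
  unfolding C1_on_def
proof (intro conjI ballI allI)
  show "continuous_on S (partial_deriv h f)" for h
    by (rule continuous_on_eq[OF assms(2)[of h]]) (simp add: partial_deriv_eq[OF assms(1)])
qed (use assms(1) in \<open>auto simp: differentiable_def\<close>)

lemma C1_onD:
  assumes "C1_on S f"
  shows "x \<in> S \<Longrightarrow> (f has_derivative frechet_derivative f (at x)) (at x)"
    and "continuous_on S (\<lambda>x. frechet_derivative f (at x) (axis h 1))"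
    and "continuous_on S (partial_deriv h f)"
  using assms frechet_derivative_works unfolding C1_on_def partial_deriv_def[abs_def] by blast+

lemma C1_on_subset: "C1_on S f \<Longrightarrow> T \<subseteq> S \<Longrightarrow> C1_on T f"
  unfolding C1_on_def by (meson continuous_on_subset subsetD)

lemma C1_on_imp_continuous_on: "C1_on S f \<Longrightarrow> continuous_on S f"
  unfolding C1_on_def
  by (meson continuous_at_imp_continuous_on differentiable_imp_continuous_within)

lemma C1_on_Un: "open S \<Longrightarrow> open T \<Longrightarrow> C1_on S f \<Longrightarrow> C1_on T f \<Longrightarrow> C1_on (S \<union> T) f"
  unfolding C1_on_def by (auto intro: continuous_on_open_Un)

lemma C1_on_cong:
  assumes "open S" "C1_on S f" "\<And>x. x \<in> S \<Longrightarrow> f x = g x"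
  shows "C1_on S g"
proof (rule C1_onI)
  show "(g has_derivative frechet_derivative f (at x)) (at x)" if "x \<in> S" for x
    by (rule has_derivative_transform_within_open[OF C1_onD(1)[OF assms(2) that] assms(1) that assms(3)])
qed (rule C1_onD(2)[OF assms(2)])

lemma C1_on_add: "C1_on S f \<Longrightarrow> C1_on S g \<Longrightarrow> C1_on S (\<lambda>x. f x + g x)"
  by (rule C1_onI[OF has_derivative_add]) (auto intro: C1_onD continuous_on_add)

lemma C1_on_const: "C1_on S (\<lambda>x. c)"
  by (rule C1_onI[OF has_derivative_const]) simp

lemma C1_on_sum: "(\<And>i. i \<in> I \<Longrightarrow> C1_on S (f i)) \<Longrightarrow> C1_on S (\<lambda>x. \<Sum>i\<in>I. f i x)"
  by (induction I rule: infinite_finite_induct) (auto intro: C1_on_add C1_on_const)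

lemma C1_on_scaleR:
  assumes "C1_on S f" "C1_on S g"
  shows "C1_on S (\<lambda>x. f x *\<^sub>R g x)"
  by (rule C1_onI[OF has_derivative_scaleR[OF C1_onD(1)[OF assms(1)] C1_onD(1)[OF assms(2)]]])
    (assumption | intro continuous_intros C1_on_imp_continuous_on[OF assms(1)] C1_on_imp_continuous_on[OF assms(2)]
      C1_onD(2)[OF assms(1)] C1_onD(2)[OF assms(2)])+

lemma C1_on_compose_real:
  assumes "C1_on S f" and "\<And>x. x \<in> S \<Longrightarrow> (F has_real_derivative F' (f x)) (at (f x))"
    and "continuous_on (f ` S) F'"
  shows "C1_on S (\<lambda>x. F (f x))"
proof (rule C1_onI)
  show "((\<lambda>x. F (f x)) has_derivative (\<lambda>d. F' (f x) * frechet_derivative f (at x) d)) (at x)" if "x \<in> S" for x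
    using has_derivative_compose[OF C1_onD(1)[OF assms(1) that] assms(2)[OF that, unfolded has_field_derivative_def]]
    by simp
  show "continuous_on S (\<lambda>x. F' (f x) * frechet_derivative f (at x) (axis h 1))" for h
    using assms(3) by (intro continuous_intros C1_onD[OF assms(1)])
      (auto intro: continuous_on_compose2 C1_on_imp_continuous_on[OF assms(1)])
qed

text \<open>A zero of the nonnegative function \<tau> is a minimum, so the derivative of \<tau>
  vanishes there. The bound |F t| \<le> t passes this on to the composition, and the bound on F'
  makes the partial derivatives of the composition tend to 0 together with those of \<tau>.\<close>

lemma C1_on_compose_at_zero:
  assumes tau: "C1_on UNIV \<tau>" "\<And>x. 0 \<le> \<tau> x"
    and F: "\<And>t. t > 0 \<Longrightarrow> (F has_real_derivative F' t) (at t)" "continuous_on {0<..} F'"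
      "F 0 = 0" "\<And>t. t > 0 \<Longrightarrow> \<bar>F t\<bar> \<le> t" "\<And>t. t > 0 \<Longrightarrow> \<bar>F' t\<bar> \<le> C"
  shows "C1_on UNIV (\<lambda>x. F (\<tau> x))"
proof (rule C1_onI)
  define G where "G = (\<lambda>x d. (if \<tau> x > 0 then F' (\<tau> x) else 0) * frechet_derivative \<tau> (at x) d)"
  have zero: "frechet_derivative \<tau> (at x) = (\<lambda>_. 0)" if "\<tau> x = 0" for x
    by (rule has_derivative_local_min[OF C1_onD(1)[OF tau(1)]]) (use tau(2) that in auto)
  show "((\<lambda>x. F (\<tau> x)) has_derivative G x) (at x)" for x
  proof (cases "\<tau> x > 0")
    case True
    show ?thesis
      using has_derivative_compose[OF C1_onD(1)[OF tau(1)] F(1)[OF True, unfolded has_field_derivative_def]] True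
      by (simp add: G_def)
  next
    case False
    then have x: "\<tau> x = 0" using tau(2)[of x] by simp
    have le: "\<bar>F (\<tau> y)\<bar> \<le> \<bar>\<tau> y\<bar>" for y
      using F(3,4) tau(2)[of y] by (cases "\<tau> y = 0") auto
    have "(\<tau> has_derivative (\<lambda>_. 0)) (at x)"
      using C1_onD(1)[OF tau(1), of x] zero[OF x] by simp
    then have "((\<lambda>y. F (\<tau> y)) has_derivative (\<lambda>_. 0)) (at x)"
      unfolding has_derivative_at_alt x F(3) diff_zero real_norm_def
      using order_trans[OF le] by blast
    then show ?thesis using False by (simp add: G_def)
  qed
  show "continuous_on UNIV (\<lambda>x. G x (axis h 1))" for h
  proof (rule continuous_at_imp_continuous_on, rule ballI)
    fix x
    have pd: "isCont (partial_deriv h \<tau>) x"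
      using C1_onD(3)[OF tau(1), of h] by (simp add: continuous_on_eq_continuous_at)
    have G: "G y (axis h 1) = (if \<tau> y > 0 then F' (\<tau> y) else 0) * partial_deriv h \<tau> y" for y
      by (simp add: G_def partial_deriv_def)
    have ct: "continuous_on UNIV \<tau>" using C1_on_imp_continuous_on[OF tau(1)] .
    show "isCont (\<lambda>x. G x (axis h 1)) x"
    proof (cases "\<tau> x > 0")
      case True
      have op: "open {x. 0 < \<tau> x}" using ct by (intro open_Collect_less) auto
      have "continuous_on {x. 0 < \<tau> x} (\<lambda>y. F' (\<tau> y) * partial_deriv h \<tau> y)"
        by (intro continuous_intros continuous_on_subset[OF C1_onD(3)[OF tau(1)]]
            continuous_on_compose2[OF F(2)] continuous_on_subset[OF ct]) auto
      then have "continuous_on {x. 0 < \<tau> x} (\<lambda>x. G x (axis h 1))"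
        by (rule continuous_on_eq) (simp add: G)
      then show ?thesis using op True continuous_on_eq_continuous_at by blast
    next
      case False
      then have x: "\<tau> x = 0" using tau(2)[of x] by simp
      have p0: "partial_deriv h \<tau> x = 0" by (simp add: partial_deriv_def zero[OF x])
      have C: "C \<ge> 0" using F(5)[of 1] by simp
      have "((\<lambda>y. C * \<bar>partial_deriv h \<tau> y\<bar>) \<longlongrightarrow> C * \<bar>partial_deriv h \<tau> x\<bar>) (at x)"
        using pd by (intro tendsto_intros) (simp add: isCont_def)
      then have lim: "((\<lambda>y. C * \<bar>partial_deriv h \<tau> y\<bar>) \<longlongrightarrow> 0) (at x)" by (simp add: p0)
      have "((\<lambda>y. G y (axis h 1)) \<longlongrightarrow> 0) (at x)"
        by (rule Lim_null_comparison[OF always_eventually lim])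
          (use F(5) C in \<open>auto simp: G abs_mult intro!: mult_right_mono\<close>)
      then show ?thesis by (simp add: isCont_def G p0)
    qed
  qed
qed

text \<open>Test functions are only required to be of class C^1, so the squared positive part is a
  sufficient building block for cut-offs.\<close>

definition ppow :: "real \<Rightarrow> real" where "ppow t = (max 0 t)\<^sup>2"

lemma DERIV_ppow: "(ppow has_real_derivative 2 * max 0 t) (at t)"
proof -
  consider "t > 0" | "t < 0" | "t = 0" by linarith
  then show ?thesis
  proof cases
    case 1
    have "((\<lambda>t. t\<^sup>2) has_real_derivative 2 * max 0 t) (at t)"
      using 1 by (auto intro!: derivative_eq_intros)
    then show ?thesis
      by (rule has_field_derivative_transform_within_open[of _ _ _ "{0<..}"]) (use 1 in \<open>auto simp: ppow_def\<close>)
  next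
    case 2
    have "((\<lambda>t. 0) has_real_derivative 2 * max 0 t) (at t)"
      using 2 by auto
    then show ?thesis
      by (rule has_field_derivative_transform_within_open[of _ _ _ "{..<0}"]) (use 2 in \<open>auto simp: ppow_def\<close>)
  next
    case 3
    have "((\<lambda>h::real. max 0 h) \<longlongrightarrow> max 0 0) (at 0)" by (intro tendsto_intros)
    then have "((\<lambda>h::real. max 0 h) \<longlongrightarrow> 0) (at 0)" by simp
    then have "((\<lambda>h::real. (ppow (0 + h) - ppow 0) / h) \<longlongrightarrow> 0) (at 0)"
      by (rule Lim_transform_eventually)
        (auto simp: eventually_at_filter ppow_def max_def power2_eq_square)
    then show ?thesis using 3 by (simp add: DERIV_def)
  qed
qed

lemma C1_on_ppow: "C1_on S f \<Longrightarrow> C1_on S (\<lambda>x. ppow (f x))"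
  by (rule C1_on_compose_real[where F' = "\<lambda>t. 2 * max 0 t"]) (auto intro!: continuous_intros DERIV_ppow)

lemma C1_on_radial: "C1_on S (\<lambda>y::real^'n. r - (norm (y - x))\<^sup>2)"
proof (rule C1_onI)
  show "((\<lambda>y. r - (norm (y - x))\<^sup>2) has_derivative (\<lambda>d. - 2 * ((y - x) \<bullet> d))) (at y)" for y
    unfolding power2_norm_eq_inner
    by (rule derivative_eq_intros refl)+ (simp add: inner_commute)
qed (intro continuous_intros)

text \<open>Finitely many balls with closures in \<Omega> cover K, and a sum f of truncated
  paraboloids over them is at least some c > 0 on K. Then \<eta> = 1 - ppow (1 - f/c) equals 1 where
  f \<ge> c and 0 where f = 0, that is, outside the balls.\<close>

lemma C1_bump:
  fixes \<Omega> :: "(real ^ 'n) set"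
  assumes "open \<Omega>" "compact K" "K \<subseteq> \<Omega>"
  obtains \<eta> K' where "C1_on UNIV \<eta>" "\<And>x. 0 \<le> \<eta> x" "\<And>x. \<eta> x \<le> 1" "\<And>x. x \<in> K \<Longrightarrow> \<eta> x = 1"
    "compact K'" "K' \<subseteq> \<Omega>" "\<And>x. x \<notin> K' \<Longrightarrow> \<eta> x = (0::real)"
proof -
  have "\<forall>x\<in>K. \<exists>r>0. cball x r \<subseteq> \<Omega>"
    using assms open_contains_cball by blast
  then obtain r where r: "\<And>x. x \<in> K \<Longrightarrow> r x > 0" "\<And>x. x \<in> K \<Longrightarrow> cball x (r x) \<subseteq> \<Omega>" by metis
  obtain D where D: "D \<subseteq> K" "finite D" "K \<subseteq> (\<Union>x\<in>D. ball x (r x))"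
    by (rule compactE_image[OF assms(2), of K "\<lambda>x. ball x (r x)"]) (use r(1) in force)+
  define f where "f = (\<lambda>y. \<Sum>x\<in>D. ppow ((r x)\<^sup>2 - (norm (y - x))\<^sup>2))"
  have f: "C1_on UNIV f" unfolding f_def by (intro C1_on_sum C1_on_ppow C1_on_radial)
  have f0: "f y \<ge> 0" for y by (simp add: f_def ppow_def sum_nonneg)
  have fpos: "f y > 0" if "y \<in> K" for y
  proof -
    have "y \<in> (\<Union>x\<in>D. ball x (r x))" using D(3) that by blast
    then obtain x where x: "x \<in> D" "norm (y - x) < r x" by (auto simp: dist_norm norm_minus_commute)
    then have "(norm (y - x))\<^sup>2 < (r x)\<^sup>2" by (intro power_strict_mono) auto
    then have "ppow ((r x)\<^sup>2 - (norm (y - x))\<^sup>2) > 0" by (simp add: ppow_def)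
    then show ?thesis unfolding f_def using D(2) x(1)
      by (intro sum_pos2[of D x]) (auto simp: ppow_def)
  qed
  obtain c where c: "c > 0" "\<And>y. y \<in> K \<Longrightarrow> c \<le> f y"
  proof (cases "K = {}")
    case False
    then obtain x where "x \<in> K" "\<forall>y\<in>K. f x \<le> f y"
      using continuous_attains_inf[OF assms(2), of f] C1_on_imp_continuous_on[OF f] continuous_on_subset by blast
    then show ?thesis using that[of "f x"] fpos by blast
  qed (use that[of 1] in auto)
  define \<eta> where "\<eta> = (\<lambda>y. 1 + (-1) *\<^sub>R ppow (1 + (- inverse c) *\<^sub>R f y))"
  show ?thesis
  proof (rule that[of \<eta> "\<Union>x\<in>D. cball x (r x)"])
    show "C1_on UNIV \<eta>" unfolding \<eta>_def
      by (intro C1_on_add C1_on_const C1_on_scaleR C1_on_ppow f)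
    show "0 \<le> \<eta> x" for x
      using f0[of x] c(1) by (auto simp: \<eta>_def ppow_def max_def intro!: power_le_one)
    show "\<eta> x \<le> 1" for x by (simp add: \<eta>_def ppow_def)
    show "\<eta> x = 1" if "x \<in> K" for x
      using c(2)[OF that] c(1) by (simp add: \<eta>_def ppow_def max_def divide_simps)
    show "compact (\<Union>x\<in>D. cball x (r x))" using D(2) by (intro compact_UN) auto
    show "(\<Union>x\<in>D. cball x (r x)) \<subseteq> \<Omega>" using D(1) r(2) by blast
    show "\<eta> y = 0" if "y \<notin> (\<Union>x\<in>D. cball x (r x))" for y
    proof -
      have "ppow ((r x)\<^sup>2 - (norm (y - x))\<^sup>2) = 0" if x: "x \<in> D" for x
      proof -
        have "r x \<le> norm (y - x)" "0 \<le> r x"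
          using \<open>y \<notin> _\<close> x D(1) r(1)[of x] by (auto simp: dist_norm norm_minus_commute)
        then have "(r x)\<^sup>2 \<le> (norm (y - x))\<^sup>2" by (intro power_mono) auto
        then show ?thesis by (simp add: ppow_def)
      qed
      then show ?thesis by (simp add: \<eta>_def f_def ppow_def)
    qed
  qed
qed

section \<open>Profiles s for which s, flux(s) and amp(s) are all of class C^1\<close>

context phi_function
begin

text \<open>The derivative of \<open>rho\<close> dominates those of the identity, \<open>flux\<close> and \<open>amp\<close>. Composed with the
  inverse of \<open>rho\<close>, all three therefore have slopes in \<open>[0, 1]\<close> and stay \<open>C\<^sup>1\<close> after composition with a
  nonnegative \<open>C\<^sup>1\<close> function, also at its zeros. This makes the test functions admissible
  whatever the behaviour of \<open>\<phi>\<close> at 0.\<close>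

definition rho :: "real \<Rightarrow> real" where "rho s = s + flux s + amp s"

definition drho :: "real \<Rightarrow> real" where
  "drho s = 1 + \<phi> s * (1 + logder s) + sqrt (\<phi> s) * (1 + logder s / 2)"

text \<open>The value 0 at nonpositive arguments is set by hand, so that the profile vanishes where
  the cut-off does.\<close>

definition rhoinv :: "real \<Rightarrow> real" where
  "rhoinv t = (if t > 0 then inv_into {0<..} rho t else 0)"

lemma DERIV_rho: "s > 0 \<Longrightarrow> (rho has_real_derivative drho s) (at s)"
  unfolding rho_def[abs_def] drho_def by (intro DERIV_add DERIV_ident DERIV_flux DERIV_amp)

lemma deriv_bounds:
  assumes "s > 0"
  shows "0 \<le> \<phi> s * (1 + logder s)" "0 \<le> sqrt (\<phi> s) * (1 + logder s / 2)" "1 \<le> drho s"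
proof -
  show *: "0 \<le> \<phi> s * (1 + logder s)" "0 \<le> sqrt (\<phi> s) * (1 + logder s / 2)"
    using logder_gt[OF assms] pos[OF assms] by simp_all
  then show "1 \<le> drho s" by (simp add: drho_def)
qed

lemma rho_strict_mono: "0 < a \<Longrightarrow> a < b \<Longrightarrow> rho a < rho b"
  using flux_strict_mono[of a b] amp_strict_mono[of a b] by (simp add: rho_def)

lemma rho_surj: assumes "y > 0" obtains s where "s > 0" "rho s = y"
proof -
  have y3: "y / 3 > 0" using assms by simp
  obtain a where a: "a > 0" "flux a = y / 3"
    using y3 flux_range by (metis greaterThan_iff imageE)
  obtain b where b: "b > 0" "amp b = y / 3" using amp_surj[OF y3] by metis
  \<comment> \<open>Each of the three summands of \<open>rho\<close> is at most y/3 at this point,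
    so \<open>rho s \<le> y\<close>; conversely \<open>rho y \<ge> y\<close> since the identity is
    one of the summands.\<close>
  define s where "s = min (min a b) (y / 3)"
  have s: "s > 0" "s \<le> a" "s \<le> b" "s \<le> y / 3" using a b assms by (auto simp: s_def)
  have "flux s \<le> flux a" "amp s \<le> amp b"
    using flux_strict_mono[OF s(1), of a] amp_strict_mono[OF s(1), of b] s(2,3)
    by (auto simp: le_less)
  then have 1: "rho s \<le> y" using a b s by (simp add: rho_def)
  have 2: "y \<le> rho y" using assms flux_pos[of y] amp_pos[of y] by (simp add: rho_def)
  have "continuous_on {s..y} rho"
    by (intro continuous_at_imp_continuous_on ballI DERIV_isCont[OF DERIV_rho]) (use s in auto)
  then obtain x where "s \<le> x" "rho x = y"
    using IVT'[of rho s y y] 1 2 s assms by auto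
  then show ?thesis using that[of x] s by simp
qed

lemma inj_on_rho: "inj_on rho {0<..}"
  by (intro linorder_inj_onI) (auto dest: rho_strict_mono)

lemma rhoinv_rho: "s > 0 \<Longrightarrow> rhoinv (rho s) = s"
  using inv_into_f_f[OF inj_on_rho] flux_pos[of s] amp_pos[of s] by (simp add: rhoinv_def rho_def)

lemma rho_pos: "s > 0 \<Longrightarrow> rho s > 0"
  using flux_pos[of s] amp_pos[of s] by (simp add: rho_def)

lemma rhoinv_pos: "t > 0 \<Longrightarrow> rhoinv t > 0" and rho_rhoinv: "t > 0 \<Longrightarrow> rho (rhoinv t) = t"
  by (metis rho_surj rhoinv_rho)+

lemma isCont_rhoinv: assumes "t > 0" shows "isCont rhoinv t"
proof -
  have s: "rhoinv t > 0" using rhoinv_pos[OF assms] .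
  have "isCont rhoinv (rho (rhoinv t))"
  proof (rule isCont_inverse_function[where d = "rhoinv t / 2" and f = rho and x = "rhoinv t"])
    show "rhoinv (rho z) = z" "isCont rho z" if "\<bar>z - rhoinv t\<bar> \<le> rhoinv t / 2" for z
    proof -
      have "z > 0" using that s by linarith
      then show "rhoinv (rho z) = z" "isCont rho z" using rhoinv_rho DERIV_isCont[OF DERIV_rho] by auto
    qed
  qed (use s in simp)
  then show ?thesis by (simp add: rho_rhoinv assms)
qed

lemma DERIV_rhoinv: assumes "t > 0" shows "(rhoinv has_real_derivative inverse (drho (rhoinv t))) (at t)"
  by (rule DERIV_inverse_function[where f = rho and a = 0 and b = "t + 1"])
    (use assms DERIV_rho[OF rhoinv_pos[OF assms]] deriv_bounds(3)[OF rhoinv_pos[OF assms]] isCont_rhoinv rho_rhoinv in auto)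

lemma C1_on_rhoinv:
  assumes tau: "C1_on UNIV \<tau>" "\<And>x. 0 \<le> \<tau> x"
    and F: "\<And>s. s > 0 \<Longrightarrow> (F has_real_derivative F' s) (at s)" "continuous_on {0<..} F'" "F 0 = 0"
      "\<And>s. s > 0 \<Longrightarrow> 0 \<le> F s \<and> F s \<le> rho s" "\<And>s. s > 0 \<Longrightarrow> 0 \<le> F' s \<and> F' s \<le> drho s"
  shows "C1_on UNIV (\<lambda>x. F (rhoinv (\<tau> x)))"
proof (rule C1_on_compose_at_zero[OF tau])
  show "((\<lambda>t. F (rhoinv t)) has_real_derivative F' (rhoinv t) * inverse (drho (rhoinv t))) (at t)" if "t > 0" for t
    using DERIV_chain2[OF F(1)[OF rhoinv_pos[OF that]] DERIV_rhoinv[OF that]] .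
  have cs: "continuous_on {0<..} rhoinv"
    by (simp add: continuous_at_imp_continuous_on isCont_rhoinv)
  have "continuous_on {0<..} drho"
    unfolding drho_def[abs_def] by (intro continuous_intros continuous_phi continuous_logder) simp
  then have cd: "continuous_on {0<..} (\<lambda>t. drho (rhoinv t))"
    by (rule continuous_on_compose2[OF _ cs]) (auto intro: rhoinv_pos)
  have cF: "continuous_on {0<..} (\<lambda>t. F' (rhoinv t))"
    by (rule continuous_on_compose2[OF F(2) cs]) (auto intro: rhoinv_pos)
  have nz: "drho (rhoinv t) \<noteq> 0" if "t > 0" for t
    using deriv_bounds(3)[OF rhoinv_pos[OF that]] by linarith
  show "continuous_on {0<..} (\<lambda>t. F' (rhoinv t) * inverse (drho (rhoinv t)))"
    by (intro continuous_on_mult continuous_on_inverse cF cd) (auto simp: nz)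
  show "F (rhoinv 0) = 0" by (simp add: rhoinv_def F)
  show "\<bar>F (rhoinv t)\<bar> \<le> t" if "t > 0" for t
    using F(4)[OF rhoinv_pos[OF that]] rho_rhoinv[OF that] by simp
  show "\<bar>F' (rhoinv t) * inverse (drho (rhoinv t))\<bar> \<le> 1" if "t > 0" for t
    using F(5)[OF rhoinv_pos[OF that]] deriv_bounds(3)[OF rhoinv_pos[OF that]]
    by (simp add: abs_mult divide_simps)
qed

text \<open>The cut-off is performed in the variable rho: the bump is multiplied by
  \<open>rho S\<close> and \<open>rhoinv\<close> is applied. The result is S where the bump is 1 and
  0 where it is 0.\<close>

lemma profile_exists:
  fixes \<Omega> :: "(real ^ 'n) set"
  assumes "open \<Omega>" "compact K" "K \<subseteq> \<Omega>" "S > 0"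
  obtains s K' where "\<And>x. 0 \<le> s x" "C1_on UNIV s" "C1_on UNIV (\<lambda>x. flux (s x))"
    "C1_on UNIV (\<lambda>x. amp (s x))" "\<And>x. x \<in> K \<Longrightarrow> s x = S"
    "compact K'" "K' \<subseteq> \<Omega>" "\<And>x. x \<notin> K' \<Longrightarrow> s x = 0"
proof -
  obtain \<eta> K' where \<eta>: "C1_on UNIV \<eta>" "\<And>x. 0 \<le> \<eta> x" "\<And>x. \<eta> x \<le> 1" "\<And>x. x \<in> K \<Longrightarrow> \<eta> x = 1"
    "compact K'" "K' \<subseteq> \<Omega>" "\<And>x. x \<notin> K' \<Longrightarrow> \<eta> x = (0::real)"
    using C1_bump[OF assms(1-3)] by blast
  define \<tau> where "\<tau> = (\<lambda>x. rho S *\<^sub>R \<eta> x)"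
  have tau1: "C1_on UNIV \<tau>" unfolding \<tau>_def by (intro C1_on_scaleR C1_on_const \<eta>)
  have tau2: "0 \<le> \<tau> x" for x
    using \<eta>(2) rho_pos[OF assms(4)] by (simp add: \<tau>_def)
  note tau = tau1 tau2
  have b: "0 \<le> flux s" "0 \<le> amp s" if "s > 0" for s
    using that flux_pos amp_pos less_imp_le by blast+
  show ?thesis
  proof (rule that[of "\<lambda>x. rhoinv (\<tau> x)" K'])
    show "C1_on UNIV (\<lambda>x. rhoinv (\<tau> x))"
      by (rule C1_on_rhoinv[OF tau, of "\<lambda>s. s" "\<lambda>s. 1"])
        (use b in \<open>auto simp: rho_def deriv_bounds add_nonneg_nonneg\<close>)
    show "C1_on UNIV (\<lambda>x. flux (rhoinv (\<tau> x)))"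
    proof (rule C1_on_rhoinv[OF tau DERIV_flux])
      show "continuous_on {0<..} (\<lambda>s. \<phi> s * (1 + logder s))"
        by (intro continuous_intros continuous_phi continuous_logder)
      show "0 \<le> \<phi> s * (1 + logder s) \<and> \<phi> s * (1 + logder s) \<le> drho s" if "s > 0" for s
        using deriv_bounds[OF that] by (simp add: drho_def)
    qed (use b in \<open>auto simp: rho_def flux_def[of 0]\<close>)
    show "C1_on UNIV (\<lambda>x. amp (rhoinv (\<tau> x)))"
    proof (rule C1_on_rhoinv[OF tau DERIV_amp])
      show "continuous_on {0<..} (\<lambda>s. sqrt (\<phi> s) * (1 + logder s / 2))"
        by (intro continuous_intros continuous_phi continuous_logder) simp
      show "0 \<le> sqrt (\<phi> s) * (1 + logder s / 2) \<and> sqrt (\<phi> s) * (1 + logder s / 2) \<le> drho s" if "s > 0" for s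
        using deriv_bounds[OF that] by (simp add: drho_def)
    qed (use b in \<open>auto simp: rho_def amp_def[of 0]\<close>)
    show "rhoinv (\<tau> x) = S" if "x \<in> K" for x
      using \<eta>(4)[OF that] assms(4) by (simp add: \<tau>_def rhoinv_rho)
    show "0 \<le> rhoinv (\<tau> x)" for x
      using rhoinv_pos[of "\<tau> x"] by (cases "\<tau> x > 0") (auto simp: rhoinv_def)
    show "rhoinv (\<tau> x) = 0" if "x \<notin> K'" for x
      using \<eta>(7)[OF that] by (simp add: \<tau>_def rhoinv_def)
  qed (rule \<eta>)+
qed

end

subsection \<open>Oscillating test functions\<close>

lemma C1_on_UNIV_in_C1_0_vec:
  fixes u :: "real ^ 'n \<Rightarrow> complex ^ 'm"
  assumes "open \<Omega>" "C1_on UNIV u" "compact K" "K \<subseteq> \<Omega>" "\<And>x. x \<notin> K \<Longrightarrow> u x = 0"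
  shows "u \<in> C1_0_vec \<Omega>"
  unfolding C1_0_vec_iff[OF assms(1)]
  using assms by (auto simp: C1_on_def intro: continuous_on_subset)

text \<open>The sum of the moduli of the entries is a crude bound, but it is integrable over compact
  sets whenever the entries are, as the dominating function later requires.\<close>

lemma norm_matrix_vector_mult_le:
  fixes M :: "complex ^ 'm ^ 'k"
  shows "norm (M *v d) \<le> (\<Sum>i\<in>UNIV. \<Sum>j\<in>UNIV. norm (M $ i $ j)) * norm d"
proof -
  have "norm (M *v d) \<le> (\<Sum>i\<in>UNIV. norm ((M *v d) $ i))"
    unfolding norm_vec_def by (rule L2_set_le_sum) simp
  also have "\<dots> \<le> (\<Sum>i\<in>UNIV. \<Sum>j\<in>UNIV. norm (M $ i $ j) * norm d)"
  proof (rule sum_mono)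
    fix i
    have "norm ((M *v d) $ i) \<le> (\<Sum>j\<in>UNIV. norm (M $ i $ j * d $ j))"
      unfolding matrix_vector_mult_def vec_lambda_beta by (rule norm_sum)
    also have "\<dots> \<le> (\<Sum>j\<in>UNIV. norm (M $ i $ j) * norm d)"
      unfolding norm_mult by (intro sum_mono mult_left_mono Finite_Cartesian_Product.norm_nth_le norm_ge_zero)
    finally show "norm ((M *v d) $ i) \<le> (\<Sum>j\<in>UNIV. norm (M $ i $ j) * norm d)" .
  qed
  finally show ?thesis by (simp add: sum_distrib_right)
qed

lemma bounded_linear_matrix_vector_mult_complex:
  fixes M :: "complex ^ 'm ^ 'k"
  shows "bounded_linear ((*v) M)"
  by (rule bounded_linear_intro[where K = "\<Sum>i\<in>UNIV. \<Sum>j\<in>UNIV. norm (M $ i $ j)"])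
    (simp_all add: matrix_vector_right_distrib matrix_vector_mult_scaleR_complex
      norm_matrix_vector_mult_le mult.commute[of "norm _"])

text \<open>The oscillating factor \<open>c\<close> need not converge, but its square factors out in the limit.\<close>

lemma tendsto_inner_oscillating:
  fixes p r :: "nat \<Rightarrow> 'a::real_inner"
  assumes p: "(\<lambda>n. p n - c n *\<^sub>R q) \<longlonglongrightarrow> 0" and r: "(\<lambda>n. r n - c n *\<^sub>R r0) \<longlonglongrightarrow> 0"
    and c: "\<And>n. \<bar>c n\<bar> \<le> 1"
  shows "(\<lambda>n. p n \<bullet> r n - (c n)\<^sup>2 * (q \<bullet> r0)) \<longlonglongrightarrow> 0"
proof -
  have osc: "(\<lambda>n. c n * x n) \<longlonglongrightarrow> 0" if "x \<longlonglongrightarrow> 0" for x :: "nat \<Rightarrow> real"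
  proof (rule Lim_null_comparison)
    show "(\<lambda>n. \<bar>x n\<bar>) \<longlonglongrightarrow> 0" using tendsto_rabs[OF that] by simp
    show "\<forall>\<^sub>F n in sequentially. norm (c n * x n) \<le> \<bar>x n\<bar>"
      using c by (auto simp: abs_mult intro!: always_eventually mult_left_le_one_le)
  qed
  note tendsto_inner[OF p r] tendsto_inner[OF p tendsto_const[of r0]] tendsto_inner[OF tendsto_const[of q] r]
  then have "(\<lambda>n. (p n - c n *\<^sub>R q) \<bullet> (r n - c n *\<^sub>R r0) + (c n * ((p n - c n *\<^sub>R q) \<bullet> r0)
      + c n * (q \<bullet> (r n - c n *\<^sub>R r0)))) \<longlonglongrightarrow> 0 + (0 + 0)"
    by (intro tendsto_add osc) simp_all
  then show ?thesis
    by (simp add: inner_diff_left inner_diff_right algebra_simps power2_eq_square)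
qed

lemma tendsto_dradial:
  assumes "continuous_on {0<..} g" "continuous_on {0<..} p" "Y \<noteq> 0" "u \<longlonglongrightarrow> Y" "e \<longlonglongrightarrow> d"
  shows "(\<lambda>n. dradial g p (u n) (e n)) \<longlonglongrightarrow> dradial g p Y d"
proof -
  have cont: "isCont g (norm Y)" "isCont p (norm Y)"
    using assms(1-3) by (auto simp: continuous_on_eq_continuous_at)
  note isCont_tendsto_compose[OF cont(1) tendsto_norm[OF assms(4)]]
    isCont_tendsto_compose[OF cont(2) tendsto_norm[OF assms(4)]]
  then show ?thesis unfolding dradial_def using assms(3-5) by (intro tendsto_intros) auto
qed

text \<open>Since c need not converge, linearity of \<open>dradial\<close> in the direction is used
  to split the difference into the image of the null sequence d - c q and c times a null
  sequence.\<close>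

lemma tendsto_dradial_oscillating:
  fixes Y :: "'a::real_inner"
  assumes g: "continuous_on {0<..} g" "continuous_on {0<..} p" "Y \<noteq> 0" "u \<longlonglongrightarrow> Y"
    and d: "(\<lambda>n. d n - c n *\<^sub>R q) \<longlonglongrightarrow> 0" and c: "\<And>n. \<bar>c n\<bar> \<le> 1"
  shows "(\<lambda>n. dradial g p (u n) (d n) - c n *\<^sub>R dradial g p Y q) \<longlonglongrightarrow> 0"
proof -
  note lin = linear_add[OF linear_dradial] linear_diff[OF linear_dradial] linear_scale[OF linear_dradial]
  have "(\<lambda>n. dradial g p (u n) (d n - c n *\<^sub>R q)) \<longlonglongrightarrow> dradial g p Y 0"
    by (rule tendsto_dradial[OF g d])
  then have 1: "(\<lambda>n. dradial g p (u n) (d n - c n *\<^sub>R q)) \<longlonglongrightarrow> 0"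
    by (simp add: dradial_def)
  have "(\<lambda>n. dradial g p (u n) q - dradial g p Y q) \<longlonglongrightarrow> 0"
    using tendsto_dradial[OF g tendsto_const] by (simp add: LIM_zero_iff)
  then have "(\<lambda>n. norm (dradial g p (u n) q - dradial g p Y q)) \<longlonglongrightarrow> 0"
    by (rule tendsto_norm_zero)
  then have 2: "(\<lambda>n. c n *\<^sub>R (dradial g p (u n) q - dradial g p Y q)) \<longlonglongrightarrow> 0"
    by (rule Lim_null_comparison[rotated])
      (use c in \<open>auto intro!: always_eventually mult_left_le_one_le\<close>)
  show ?thesis
    using tendsto_add[OF 1 2] by (simp add: lin algebra_simps)
qed

text \<open>The lower bound a on |y| keeps y away from the origin, where g and p may be singular;
  continuity on a compact annulus times a ball gives C.\<close>

lemma dradial_bounded: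
  fixes B :: real
  assumes "continuous_on {0<..} g" "continuous_on {0<..} p" "0 < a"
  obtains C where "C \<ge> 0" "\<And>y d :: 'a::euclidean_space. a \<le> norm y \<Longrightarrow> norm y \<le> b \<Longrightarrow> norm d \<le> B \<Longrightarrow>
    norm (dradial g p y d) \<le> C"
proof -
  define S where "S = (cball (0::'a) b - ball 0 a) \<times> cball (0::'a) B"
  have "compact S" unfolding S_def by (intro compact_Times compact_diff compact_cball) auto
  moreover have "continuous_on S (\<lambda>z. dradial g p (fst z) (snd z))"
    using assms by (intro continuous_on_dradial continuous_intros) (auto simp: S_def)
  ultimately have "bounded ((\<lambda>z. dradial g p (fst z) (snd z)) ` S)"
    by (intro compact_imp_bounded compact_continuous_image)
  then obtain C where C: "C > 0" "\<And>z. z \<in> S \<Longrightarrow> norm (dradial g p (fst z) (snd z)) \<le> C"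
    by (auto simp: bounded_pos)
  show ?thesis
  proof (rule that[of C])
    show "norm (dradial g p y d) \<le> C" if "a \<le> norm y" "norm y \<le> b" "norm d \<le> B" for y d :: 'a
      using C(2)[of "(y, d)"] that by (simp add: S_def)
  qed (use C in simp)
qed

text \<open>The integrand of the dissipativity inequality, left side minus right side. The arguments
  w and v will be \<phi>(|u|) u and sqrt (\<phi>(|u|)) u.\<close>

definition dissipation_gap :: "('n \<Rightarrow> real ^ 'n \<Rightarrow> complex ^ 'm ^ 'm) \<Rightarrow> real \<Rightarrow> (real ^ 'n \<Rightarrow> complex ^ 'm) \<Rightarrow>
    (real ^ 'n \<Rightarrow> complex ^ 'm) \<Rightarrow> (real ^ 'n \<Rightarrow> complex ^ 'm) \<Rightarrow> real ^ 'n \<Rightarrow> real" where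
  "dissipation_gap A \<kappa> u w v x = (\<Sum>k\<in>UNIV. (A k x *v partial_deriv k u x) \<bullet> partial_deriv k w x
      - \<kappa> * (norm (partial_deriv k v x))\<^sup>2)"

lemma dissipation_gap_integral:
  fixes A :: "'n \<Rightarrow> real ^ 'n \<Rightarrow> complex ^ 'm ^ 'm"
  assumes "open \<Omega>" and A: "\<And>h i j. (\<lambda>x. A h x $ i $ j) \<in> L1_loc \<Omega>"
    and K: "compact K" "K \<subseteq> \<Omega>"
    and u: "C1_on UNIV u" "\<And>x. x \<notin> K \<Longrightarrow> u x = 0"
    and w: "C1_on UNIV w" "\<And>x. x \<notin> K \<Longrightarrow> w x = 0"
    and v: "C1_on UNIV v" "\<And>x. x \<notin> K \<Longrightarrow> v x = 0"
  shows "integrable lebesgue (\<lambda>x. indicator \<Omega> x * dissipation_gap A \<kappa> u w v x)"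
    and "(\<integral>x. indicator \<Omega> x * dissipation_gap A \<kappa> u w v x \<partial>lebesgue) =
      Re (LINT x:\<Omega>|lebesgue. \<Sum>h\<in>UNIV. herm_inner (A h x *v partial_deriv h u x) (partial_deriv h w x))
      - \<kappa> * (LINT x:\<Omega>|lebesgue. \<Sum>h\<in>UNIV. (norm (partial_deriv h v x))\<^sup>2)"
proof -
  define f where "f = (\<lambda>x. \<Sum>h\<in>UNIV. herm_inner (A h x *v partial_deriv h u x) (partial_deriv h w x))"
  define g where "g = (\<lambda>x. \<Sum>h\<in>UNIV. (norm (partial_deriv h v x))\<^sup>2)"
  have f: "integrable lebesgue (\<lambda>x. indicator \<Omega> x *\<^sub>R f x)"
    using set_integrable_dissipation[OF assms(1) A C1_on_UNIV_in_C1_0_vec[OF assms(1) u(1) K u(2)]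
        C1_on_UNIV_in_C1_0_vec[OF assms(1) w(1) K w(2)]]
    by (simp add: f_def set_integrable_def)
  have "partial_deriv h v x = 0" if "x \<notin> K" for h x
    by (rule partial_deriv_eq_0[of "- K"]) (use that K v in \<open>auto simp: compact_imp_closed\<close>)
  then have g0: "g x = 0" if "x \<notin> K" for x using that by (simp add: g_def)
  have "continuous_on K g"
    unfolding g_def by (intro continuous_intros continuous_on_subset[OF C1_onD(3)[OF v(1)]]) auto
  then have "integrable lborel (\<lambda>x. indicator K x *\<^sub>R g x)"
    by (rule borel_integrable_compact[OF K(1)])
  moreover have "indicator K x *\<^sub>R g x = indicator \<Omega> x *\<^sub>R g x" for x
    using g0[of x] K(2) by (auto simp: indicator_def)
  ultimately have "integrable lborel (\<lambda>x. indicator \<Omega> x *\<^sub>R g x)" by (simp only:)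
  then have g: "integrable lebesgue (\<lambda>x. indicator \<Omega> x *\<^sub>R g x)"
    using integrable_completion borel_measurable_integrable by blast
  have eq: "indicator \<Omega> x * dissipation_gap A \<kappa> u w v x = Re (indicator \<Omega> x *\<^sub>R f x) - \<kappa> * (indicator \<Omega> x *\<^sub>R g x)" for x
    by (simp add: dissipation_gap_def f_def g_def Re_herm_inner sum_subtractf sum_distrib_left algebra_simps)
  show "integrable lebesgue (\<lambda>x. indicator \<Omega> x * dissipation_gap A \<kappa> u w v x)"
    unfolding eq using f g by (intro Bochner_Integration.integrable_diff integrable_Re integrable_mult_right)
  have "(\<integral>x. indicator \<Omega> x * dissipation_gap A \<kappa> u w v x \<partial>lebesgue) =
    (\<integral>x. Re (indicator \<Omega> x *\<^sub>R f x) \<partial>lebesgue) - (\<integral>x. \<kappa> * (indicator \<Omega> x *\<^sub>R g x) \<partial>lebesgue)"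
    unfolding eq using f g by (intro Bochner_Integration.integral_diff integrable_Re integrable_mult_right)
  also have "\<dots> = Re (LINT x:\<Omega>|lebesgue. f x) - \<kappa> * (LINT x:\<Omega>|lebesgue. g x)"
    unfolding set_lebesgue_integral_def integral_Re[OF f] by simp
  finally show "(\<integral>x. indicator \<Omega> x * dissipation_gap A \<kappa> u w v x \<partial>lebesgue) =
      Re (LINT x:\<Omega>|lebesgue. \<Sum>h\<in>UNIV. herm_inner (A h x *v partial_deriv h u x) (partial_deriv h w x))
      - \<kappa> * (LINT x:\<Omega>|lebesgue. \<Sum>h\<in>UNIV. (norm (partial_deriv h v x))\<^sup>2)"
    by (simp add: f_def g_def)
qed

section \<open>Passage to the limit in the oscillating test functions\<close>

context phi_function
begin

lemma continuous_sqrt_phi: "continuous_on {0<..} (\<lambda>s. sqrt (\<phi> s))"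
  by (intro continuous_intros continuous_phi)

lemma continuous_half_logder: "continuous_on {0<..} (\<lambda>s. logder s / 2)"
  by (intro continuous_intros continuous_logder) simp

lemma C1_on_flux_compose:
  fixes u :: "real ^ 'n \<Rightarrow> 'a::real_inner"
  assumes u: "C1_on S u" "\<And>x. x \<in> S \<Longrightarrow> u x \<noteq> 0"
  shows "C1_on S (\<lambda>x. \<phi> (norm (u x)) *\<^sub>R u x)"
    and "\<And>x k. x \<in> S \<Longrightarrow> partial_deriv k (\<lambda>x. \<phi> (norm (u x)) *\<^sub>R u x) x = dflux (u x) (partial_deriv k u x)"
proof -
  have d: "((\<lambda>x. \<phi> (norm (u x)) *\<^sub>R u x) has_derivative (\<lambda>d. dflux (u x) (frechet_derivative u (at x) d))) (at x)"
    if "x \<in> S" for x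
    by (rule has_derivative_compose[OF C1_onD(1)[OF u(1) that] has_derivative_flux[OF u(2)[OF that]]])
  show "C1_on S (\<lambda>x. \<phi> (norm (u x)) *\<^sub>R u x)"
    by (rule C1_onI[OF d], assumption)
      (use u C1_on_imp_continuous_on[OF u(1)] C1_onD(2)[OF u(1)] in
        \<open>auto simp: dflux_def intro!: continuous_on_dradial continuous_phi continuous_logder\<close>)
  show "partial_deriv k (\<lambda>x. \<phi> (norm (u x)) *\<^sub>R u x) x = dflux (u x) (partial_deriv k u x)" if "x \<in> S" for x k
    unfolding partial_deriv_eq[OF d[OF that]] by (simp add: partial_deriv_def)
qed

lemma C1_on_amp_compose:
  fixes u :: "real ^ 'n \<Rightarrow> 'a::real_inner"
  assumes u: "C1_on S u" "\<And>x. x \<in> S \<Longrightarrow> u x \<noteq> 0"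
  shows "C1_on S (\<lambda>x. sqrt (\<phi> (norm (u x))) *\<^sub>R u x)"
    and "\<And>x k. x \<in> S \<Longrightarrow> partial_deriv k (\<lambda>x. sqrt (\<phi> (norm (u x))) *\<^sub>R u x) x = damp (u x) (partial_deriv k u x)"
proof -
  have d: "((\<lambda>x. sqrt (\<phi> (norm (u x))) *\<^sub>R u x) has_derivative (\<lambda>d. damp (u x) (frechet_derivative u (at x) d))) (at x)"
    if "x \<in> S" for x
    by (rule has_derivative_compose[OF C1_onD(1)[OF u(1) that] has_derivative_amp[OF u(2)[OF that]]])
  show "C1_on S (\<lambda>x. sqrt (\<phi> (norm (u x))) *\<^sub>R u x)"
    by (rule C1_onI[OF d], assumption)
      (use u C1_on_imp_continuous_on[OF u(1)] C1_onD(2)[OF u(1)] in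
        \<open>auto simp: damp_def intro!: continuous_on_dradial continuous_sqrt_phi continuous_half_logder\<close>)
  show "partial_deriv k (\<lambda>x. sqrt (\<phi> (norm (u x))) *\<^sub>R u x) x = damp (u x) (partial_deriv k u x)" if "x \<in> S" for x k
    unfolding partial_deriv_eq[OF d[OF that]] by (simp add: partial_deriv_def)
qed

text \<open>Here Y is the value near which u stays on K, and \<zeta> the direction of its
  oscillation. Off K the gap does not depend on the frequency, so division by the square of N
  removes it in the limit; on K the sum over the two phases converges, and dominated convergence
  applies.\<close>

lemma oscillation_inequality:
  fixes A :: "'n \<Rightarrow> real ^ 'n \<Rightarrow> complex ^ 'm ^ 'm" and \<psi> :: "real ^ 'n \<Rightarrow> real"
  assumes \<Omega>: "open \<Omega>" and A: "\<And>h i j. (\<lambda>x. A h x $ i $ j) \<in> L1_loc \<Omega>"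
    and diss: "\<And>u. u \<in> C1_0_vec \<Omega> \<Longrightarrow> (\<lambda>x. \<phi> (norm (u x)) *\<^sub>R u x) \<in> C1_0_vec \<Omega> \<Longrightarrow>
      \<kappa> * (LINT x:\<Omega>|lebesgue. \<Sum>h\<in>UNIV. (norm (partial_deriv h (\<lambda>y. sqrt (\<phi> (norm (u y))) *\<^sub>R u y) x))\<^sup>2)
      \<le> Re (LINT x:\<Omega>|lebesgue. \<Sum>h\<in>UNIV. herm_inner (A h x *v partial_deriv h u x)
          (partial_deriv h (\<lambda>y. \<phi> (norm (u y)) *\<^sub>R u y) x))"
    and \<kappa>: "\<kappa> \<ge> 0" and K: "compact K" "K \<subseteq> \<Omega>"
    and \<psi>: "C1_on UNIV \<psi>" "\<And>x. 0 \<le> \<psi> x" "\<And>x. \<psi> x \<le> 1" "\<And>x. x \<notin> K \<Longrightarrow> \<psi> x = 0"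
    and Y: "Y \<noteq> 0"
  shows "0 \<le> (\<integral>x. indicator \<Omega> x * ((\<psi> x)\<^sup>2 *
      ((A h x *v \<zeta>) \<bullet> dflux Y \<zeta> - \<kappa> * (norm (damp Y \<zeta>))\<^sup>2)) \<partial>lebesgue)"
proof -
  define S \<omega> where "S = norm Y" and "\<omega> = sgn Y"
  have S: "S > 0" and \<omega>: "norm \<omega> = 1" and S\<omega>: "S *\<^sub>R \<omega> = Y"
    using Y by (simp_all add: S_def \<omega>_def norm_sgn sgn_div_norm)
  obtain s K' where s: "\<And>x. 0 \<le> s x" "C1_on UNIV s" "C1_on UNIV (\<lambda>x. flux (s x))"
    "C1_on UNIV (\<lambda>x. amp (s x))" "\<And>x. x \<in> K \<Longrightarrow> s x = S"
    "compact K'" "K' \<subseteq> \<Omega>" "\<And>x. x \<notin> K' \<Longrightarrow> s x = 0"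
    using profile_exists[OF \<Omega> K S] by blast
  have KK': "K \<subseteq> K'" using s(5,8) S by fastforce
  \<comment> \<open>The threshold keeps the perturbation, of size at most |\<zeta>|/N, below S/2. On
    K all the test functions then take values in the annulus between S/2 and 3S/2, away from the
    zero of u.\<close>
  obtain N0 :: nat where N0: "max 1 (2 * norm \<zeta> / S) \<le> real N0" using real_arch_simple by blast
  define N where "N n = real (n + N0)" for n
  have N1: "N n \<ge> 1" and NS: "norm \<zeta> / N n \<le> S / 2" for n
  proof -
    have "max 1 (2 * norm \<zeta> / S) \<le> N n" using N0 by (simp add: N_def)
    then show "N n \<ge> 1" "norm \<zeta> / N n \<le> S / 2"
      using S by (auto simp: divide_simps mult.commute)
  qed
  have Npos: "N n > 0" for n using N1[of n] by simp
  have Nlim: "(\<lambda>n. inverse (N n)) \<longlonglongrightarrow> 0"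
    unfolding N_def by (rule LIMSEQ_ignore_initial_segment[OF lim_inverse_n])
  define u where "u \<theta> n x = s x *\<^sub>R \<omega> + (\<psi> x *\<^sub>R (sin ((N n)\<^sup>2 * (x $ h) + \<theta>) / N n)) *\<^sub>R \<zeta>" for \<theta> n x
  define w where "w \<theta> n x = \<phi> (norm (u \<theta> n x)) *\<^sub>R u \<theta> n x" for \<theta> n x
  define v where "v \<theta> n x = sqrt (\<phi> (norm (u \<theta> n x))) *\<^sub>R u \<theta> n x" for \<theta> n x
  \<comment> \<open>The k-th partial derivative of u divided by N, as \<open>pd_u\<close> shows. The
    first two terms tend to 0; the last one is bounded, oscillates, and is present only for k =
    h.\<close>
  define P where "P \<theta> n k x = (inverse (N n) * partial_deriv k s x) *\<^sub>R \<omega> +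
      (partial_deriv k \<psi> x * (sin ((N n)\<^sup>2 * (x $ h) + \<theta>) * inverse (N n) * inverse (N n))) *\<^sub>R \<zeta> +
      cos ((N n)\<^sup>2 * (x $ h) + \<theta>) *\<^sub>R (if k = h then \<psi> x *\<^sub>R \<zeta> else 0)" for \<theta> n k x
  have wave: "((\<lambda>x. sin ((N n)\<^sup>2 * (x $ h) + \<theta>) / N n) has_derivative
      (\<lambda>d. cos ((N n)\<^sup>2 * (x $ h) + \<theta>) * (N n * (d $ h)))) (at x)" for n \<theta> and x :: "real ^ 'n"
    by (rule derivative_eq_intros bounded_linear.has_derivative[OF bounded_linear_vec_nth] refl)+
      (use Npos[of n] in \<open>simp_all add: power2_eq_square fun_eq_iff\<close>)
  have C1_wave: "C1_on UNIV (\<lambda>x. sin ((N n)\<^sup>2 * (x $ h) + \<theta>) / N n)" for n \<theta>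
    by (rule C1_onI[OF wave]) (intro continuous_intros)
  have C1_u: "C1_on UNIV (u \<theta> n)" for \<theta> n
    unfolding u_def by (intro C1_on_add C1_on_scaleR C1_on_const s \<psi> C1_wave)
  have NN: "N n * (inverse (N n) * a) = a" for n a
    using Npos[of n] by simp
  have pd_u: "partial_deriv k (u \<theta> n) x = N n *\<^sub>R P \<theta> n k x" for \<theta> n k x
  proof -
    have "(u \<theta> n has_derivative (\<lambda>d. frechet_derivative s (at x) d *\<^sub>R \<omega> +
      (\<psi> x *\<^sub>R (cos ((N n)\<^sup>2 * (x $ h) + \<theta>) * (N n * (d $ h))) +
       frechet_derivative \<psi> (at x) d *\<^sub>R (sin ((N n)\<^sup>2 * (x $ h) + \<theta>) / N n)) *\<^sub>R \<zeta>)) (at x)"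
      unfolding u_def
      by (intro has_derivative_add has_derivative_scaleR_left has_derivative_scaleR wave
          C1_onD(1)[OF s(2)] C1_onD(1)[OF \<psi>(1)] UNIV_I)
    from partial_deriv_eq[OF this, of k] show ?thesis
      by (auto simp: P_def axis_def partial_deriv_def algebra_simps divide_inverse NN)
  qed
  have near: "norm (u \<theta> n x - Y) \<le> S / 2" and conv: "norm (u \<theta> n x - Y) \<le> norm \<zeta> * inverse (N n)"
    if "x \<in> K" for \<theta> n x
  proof -
    have "norm (u \<theta> n x - Y) = \<psi> x * \<bar>sin ((N n)\<^sup>2 * (x $ h) + \<theta>)\<bar> * (norm \<zeta> / N n)"
      using s(5)[OF that] S\<omega> Npos[of n] \<psi>(2)[of x] by (simp add: u_def abs_mult)
    also have "\<dots> \<le> 1 * (norm \<zeta> / N n)"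
      using \<psi>(2,3) Npos[of n] by (intro mult_right_mono mult_le_one) auto
    finally have le: "norm (u \<theta> n x - Y) \<le> norm \<zeta> / N n" by simp
    then show "norm (u \<theta> n x - Y) \<le> norm \<zeta> * inverse (N n)" by (simp only: divide_inverse)
    show "norm (u \<theta> n x - Y) \<le> S / 2" by (rule order_trans[OF le NS])
  qed
  have annulus: "S / 2 \<le> norm (u \<theta> n x)" "norm (u \<theta> n x) \<le> 3 * S / 2" if "x \<in> K" for \<theta> n x
    using near[OF that, of \<theta> n] norm_triangle_ineq2[of Y "u \<theta> n x"] norm_triangle_ineq2[of "u \<theta> n x" Y]
    by (simp_all add: S_def norm_minus_commute)
  \<comment> \<open>Regularity of w and v is checked on two open sets covering the space: on
    \<open>O1\<close>, where u is nonzero, by the chain rule, and off K, where they coincide with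
    \<open>w0\<close> and \<open>v0\<close>, which are of class C^1 by the choice of the profile
    even at its zeros.\<close>
  define O1 where "O1 \<theta> n = {x. u \<theta> n x \<noteq> 0}" for \<theta> n
  have O1: "open (O1 \<theta> n)" for \<theta> n
    unfolding O1_def using C1_on_imp_continuous_on[OF C1_u[of \<theta> n]]
    by (intro open_Collect_neq) auto
  have O2: "open (- K)" using compact_imp_closed[OF K(1)] by (simp add: open_Compl)
  have cover: "O1 \<theta> n \<union> - K = UNIV" and KO1: "K \<subseteq> O1 \<theta> n" for \<theta> n
  proof -
    have "u \<theta> n x \<noteq> 0" if "x \<in> K" for x using annulus(1)[OF that, of \<theta> n] S by auto
    then show "K \<subseteq> O1 \<theta> n" by (auto simp: O1_def)
    then show "O1 \<theta> n \<union> - K = UNIV" by blast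
  qed
  define u0 where "u0 x = s x *\<^sub>R \<omega>" for x
  define w0 where "w0 x = flux (s x) *\<^sub>R \<omega>" for x
  define v0 where "v0 x = amp (s x) *\<^sub>R \<omega>" for x
  have C1_0: "C1_on UNIV u0" "C1_on UNIV w0" "C1_on UNIV v0"
    unfolding u0_def w0_def v0_def by (intro C1_on_scaleR C1_on_const s)+
  have off: "u \<theta> n x = u0 x" "w \<theta> n x = w0 x" "v \<theta> n x = v0 x" if "x \<in> - K" for \<theta> n x
    using \<psi>(4)[of x] that s(1)[of x] \<omega>
    by (simp_all add: u_def w_def v_def u0_def w0_def v0_def flux_def amp_def)
  have C1_w: "C1_on UNIV (w \<theta> n)" for \<theta> n
    unfolding cover[of \<theta> n, symmetric]
  proof (rule C1_on_Un[OF O1 O2])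
    show "C1_on (O1 \<theta> n) (w \<theta> n)" unfolding w_def
      by (rule C1_on_flux_compose(1)[OF C1_on_subset[OF C1_u]]) (auto simp: O1_def)
    show "C1_on (- K) (w \<theta> n)"
      by (rule C1_on_cong[OF O2 C1_on_subset[OF C1_0(2)]]) (simp_all add: off)
  qed
  have C1_v: "C1_on UNIV (v \<theta> n)" for \<theta> n
    unfolding cover[of \<theta> n, symmetric]
  proof (rule C1_on_Un[OF O1 O2])
    show "C1_on (O1 \<theta> n) (v \<theta> n)" unfolding v_def
      by (rule C1_on_amp_compose(1)[OF C1_on_subset[OF C1_u]]) (auto simp: O1_def)
    show "C1_on (- K) (v \<theta> n)"
      by (rule C1_on_cong[OF O2 C1_on_subset[OF C1_0(3)]]) (simp_all add: off)
  qed
  have outside: "u \<theta> n x = 0" "w \<theta> n x = 0" "v \<theta> n x = 0" "u0 x = 0" "w0 x = 0" "v0 x = 0"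
    if "x \<notin> K'" for \<theta> n x
  proof -
    have x: "x \<in> - K" "s x = 0" using that KK' s(8) by auto
    then show "u \<theta> n x = 0" "w \<theta> n x = 0" "v \<theta> n x = 0" "u0 x = 0" "w0 x = 0" "v0 x = 0"
      by (simp_all add: off u0_def w0_def v0_def flux_def amp_def)
  qed
  have gap_0: "integrable lebesgue (\<lambda>x. indicator \<Omega> x * dissipation_gap A \<kappa> u0 w0 v0 x)"
    by (rule dissipation_gap_integral(1)[OF \<Omega> A s(6,7) C1_0(1) outside(4) C1_0(2) outside(5) C1_0(3) outside(6)])
  define G where "G \<theta> n x = indicator \<Omega> x * dissipation_gap A \<kappa> (u \<theta> n) (w \<theta> n) (v \<theta> n) x" for \<theta> n x
  have G_int: "integrable lebesgue (G \<theta> n)" for \<theta> n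
    unfolding G_def
    by (rule dissipation_gap_integral(1)[OF \<Omega> A s(6,7) C1_u outside(1) C1_w outside(2) C1_v outside(3)])
  have G_nonneg: "0 \<le> (\<integral>x. G \<theta> n x \<partial>lebesgue)" for \<theta> n
  proof -
    have "u \<theta> n \<in> C1_0_vec \<Omega>" "w \<theta> n \<in> C1_0_vec \<Omega>"
      using C1_on_UNIV_in_C1_0_vec[OF \<Omega> C1_u s(6,7) outside(1)]
        C1_on_UNIV_in_C1_0_vec[OF \<Omega> C1_w s(6,7) outside(2)] by blast+
    moreover have "(\<lambda>x. \<phi> (norm (u \<theta> n x)) *\<^sub>R u \<theta> n x) = w \<theta> n"
      "(\<lambda>x. sqrt (\<phi> (norm (u \<theta> n x))) *\<^sub>R u \<theta> n x) = v \<theta> n"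
      by (simp_all add: w_def v_def fun_eq_iff)
    ultimately have d: "\<kappa> * (LINT x:\<Omega>|lebesgue. \<Sum>h\<in>UNIV. (norm (partial_deriv h (v \<theta> n) x))\<^sup>2)
      \<le> Re (LINT x:\<Omega>|lebesgue. \<Sum>h\<in>UNIV. herm_inner (A h x *v partial_deriv h (u \<theta> n) x)
          (partial_deriv h (w \<theta> n) x))"
      using diss[of "u \<theta> n"] by simp
    have "(\<integral>x. G \<theta> n x \<partial>lebesgue) =
      Re (LINT x:\<Omega>|lebesgue. \<Sum>h\<in>UNIV. herm_inner (A h x *v partial_deriv h (u \<theta> n) x)
          (partial_deriv h (w \<theta> n) x))
      - \<kappa> * (LINT x:\<Omega>|lebesgue. \<Sum>h\<in>UNIV. (norm (partial_deriv h (v \<theta> n) x))\<^sup>2)"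
      unfolding G_def
      by (rule dissipation_gap_integral(2)[OF \<Omega> A s(6,7) C1_u outside(1) C1_w outside(2) C1_v outside(3)])
    with d show ?thesis by linarith
  qed
  have G_off: "G \<theta> n x = indicator \<Omega> x * dissipation_gap A \<kappa> u0 w0 v0 x" if "x \<in> - K" for \<theta> n x
  proof -
    have "partial_deriv k (u \<theta> n) x = partial_deriv k u0 x"
      "partial_deriv k (w \<theta> n) x = partial_deriv k w0 x"
      "partial_deriv k (v \<theta> n) x = partial_deriv k v0 x" for k
      using C1_u[of \<theta> n] C1_w[of \<theta> n] C1_v[of \<theta> n]
      by (auto simp: C1_on_def intro!: partial_deriv_cong[OF O2 that] off)
    then show ?thesis by (simp add: G_def dissipation_gap_def)
  qed
  \<comment> \<open>Both \<open>dflux\<close> and \<open>damp\<close> are linear in the direction,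
    so replacing the derivative of u by N times P pulls the square of N out of the gap; T is the
    remaining contribution of direction k.\<close>
  define T where "T \<theta> n k x = (A k x *v P \<theta> n k x) \<bullet> dflux (u \<theta> n x) (P \<theta> n k x)
      - \<kappa> * (norm (damp (u \<theta> n x) (P \<theta> n k x)))\<^sup>2" for \<theta> n k x
  have G_on: "G \<theta> n x = (N n)\<^sup>2 * (\<Sum>k\<in>UNIV. T \<theta> n k x)" if "x \<in> K" for \<theta> n x
  proof -
    have x: "x \<in> O1 \<theta> n" using KO1 that by blast
    have C1: "C1_on (O1 \<theta> n) (u \<theta> n)" "\<And>y. y \<in> O1 \<theta> n \<Longrightarrow> u \<theta> n y \<noteq> 0"
      by (rule C1_on_subset[OF C1_u]) (simp_all add: O1_def)
    have weq: "w \<theta> n = (\<lambda>x. \<phi> (norm (u \<theta> n x)) *\<^sub>R u \<theta> n x)"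
      and veq: "v \<theta> n = (\<lambda>x. sqrt (\<phi> (norm (u \<theta> n x))) *\<^sub>R u \<theta> n x)"
      by (simp_all add: w_def v_def fun_eq_iff)
    have fc: "partial_deriv k (\<lambda>x. \<phi> (norm (u \<theta> n x)) *\<^sub>R u \<theta> n x) x = dflux (u \<theta> n x) (partial_deriv k (u \<theta> n) x)" for k
      by (rule C1_on_flux_compose(2)[OF C1 x])
    have ac: "partial_deriv k (\<lambda>x. sqrt (\<phi> (norm (u \<theta> n x))) *\<^sub>R u \<theta> n x) x = damp (u \<theta> n x) (partial_deriv k (u \<theta> n) x)" for k
      by (rule C1_on_amp_compose(2)[OF C1 x])
    have pd_w: "partial_deriv k (w \<theta> n) x = N n *\<^sub>R dflux (u \<theta> n x) (P \<theta> n k x)"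
      and pd_v: "partial_deriv k (v \<theta> n) x = N n *\<^sub>R damp (u \<theta> n x) (P \<theta> n k x)" for k
      unfolding weq veq fc ac pd_u
      by (simp_all only: dflux_def damp_def linear_scale[OF linear_dradial])
    have "(N n *\<^sub>R a) \<bullet> (N n *\<^sub>R b) - \<kappa> * (norm (N n *\<^sub>R c))\<^sup>2 = (N n)\<^sup>2 * (a \<bullet> b - \<kappa> * (norm c)\<^sup>2)"
      for a b c :: "complex ^ 'm"
      by (simp add: power_mult_distrib power2_eq_square algebra_simps)
    then have "dissipation_gap A \<kappa> (u \<theta> n) (w \<theta> n) (v \<theta> n) x = (\<Sum>k\<in>UNIV. (N n)\<^sup>2 * T \<theta> n k x)"
      unfolding dissipation_gap_def pd_u T_def pd_w pd_v matrix_vector_mult_scaleR_complex by (simp only:)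
    then show ?thesis using that K by (auto simp: G_def sum_distrib_left)
  qed

  define F where "F x = (A h x *v \<zeta>) \<bullet> dflux Y \<zeta> - \<kappa> * (norm (damp Y \<zeta>))\<^sup>2" for x
  have T_lim: "(\<lambda>n. (\<Sum>k\<in>UNIV. T \<theta> n k x) - (cos ((N n)\<^sup>2 * (x $ h) + \<theta>))\<^sup>2 * ((\<psi> x)\<^sup>2 * F x)) \<longlonglongrightarrow> 0"
    if x: "x \<in> K" for \<theta> x
  proof -
    define c where "c n = cos ((N n)\<^sup>2 * (x $ h) + \<theta>)" for n
    have c1: "\<bar>c n\<bar> \<le> 1" for n by (simp add: c_def)
    \<comment> \<open>The leading direction of P without its oscillating factor. It vanishes for k
      other than h, so the limit of the sum over k retains the single term with F.\<close>
    define q where "q k = (if k = h then \<psi> x *\<^sub>R \<zeta> else 0)" for k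
    have "(\<lambda>n. norm \<zeta> * inverse (N n)) \<longlonglongrightarrow> norm \<zeta> * 0" by (intro tendsto_intros Nlim)
    then have "(\<lambda>n. norm \<zeta> * inverse (N n)) \<longlonglongrightarrow> 0" by simp
    then have "(\<lambda>n. u \<theta> n x - Y) \<longlonglongrightarrow> 0"
      by (rule Lim_null_comparison[OF always_eventually, rotated]) (use conv[OF x] in blast)
    then have uY: "(\<lambda>n. u \<theta> n x) \<longlonglongrightarrow> Y" by (simp add: LIM_zero_iff)
    have "\<bar>sin ((N n)\<^sup>2 * (x $ h) + \<theta>) * inverse (N n) * inverse (N n)\<bar> \<le> 1 * inverse (N n) * 1" for n
      unfolding abs_mult using Npos[of n] N1[of n]
      by (intro mult_mono) (auto simp: divide_simps)
    then have sinlim: "(\<lambda>n. sin ((N n)\<^sup>2 * (x $ h) + \<theta>) * inverse (N n) * inverse (N n)) \<longlonglongrightarrow> 0"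
      by (intro Lim_null_comparison[OF always_eventually Nlim]) simp
    have Pq: "(\<lambda>n. P \<theta> n k x - c n *\<^sub>R q k) \<longlonglongrightarrow> 0" for k
    proof -
      have "(\<lambda>n. (inverse (N n) * partial_deriv k s x) *\<^sub>R \<omega> +
        (partial_deriv k \<psi> x * (sin ((N n)\<^sup>2 * (x $ h) + \<theta>) * inverse (N n) * inverse (N n))) *\<^sub>R \<zeta>)
        \<longlonglongrightarrow> (0 * partial_deriv k s x) *\<^sub>R \<omega> + (partial_deriv k \<psi> x * 0) *\<^sub>R \<zeta>"
        by (intro tendsto_intros Nlim sinlim)
      then show ?thesis by (simp add: P_def c_def q_def)
    qed
    have AP: "(\<lambda>n. A k x *v P \<theta> n k x - c n *\<^sub>R (A k x *v q k)) \<longlonglongrightarrow> 0" for k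
    proof -
      have "(\<lambda>n. A k x *v (P \<theta> n k x - c n *\<^sub>R q k)) \<longlonglongrightarrow> A k x *v 0"
        by (rule bounded_linear.tendsto[OF bounded_linear_matrix_vector_mult_complex Pq])
      then show ?thesis by (simp add: matrix_vector_mult_diff_distrib matrix_vector_mult_scaleR_complex)
    qed
    note fP = tendsto_dradial_oscillating[OF continuous_phi continuous_logder Y uY Pq c1, folded dflux_def]
    note aP = tendsto_dradial_oscillating[OF continuous_sqrt_phi continuous_half_logder Y uY Pq c1, folded damp_def]
    have "(\<lambda>n. T \<theta> n k x - (c n)\<^sup>2 * ((A k x *v q k) \<bullet> dflux Y (q k) - \<kappa> * (norm (damp Y (q k)))\<^sup>2)) \<longlonglongrightarrow> 0" for k
    proof -
      have "(\<lambda>n. ((A k x *v P \<theta> n k x) \<bullet> dflux (u \<theta> n x) (P \<theta> n k x) - (c n)\<^sup>2 * ((A k x *v q k) \<bullet> dflux Y (q k)))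
        - \<kappa> * (damp (u \<theta> n x) (P \<theta> n k x) \<bullet> damp (u \<theta> n x) (P \<theta> n k x) - (c n)\<^sup>2 * (damp Y (q k) \<bullet> damp Y (q k))))
        \<longlonglongrightarrow> 0 - \<kappa> * 0"
        by (intro tendsto_intros tendsto_inner_oscillating AP fP aP c1)
      then show ?thesis by (simp add: T_def power2_norm_eq_inner algebra_simps)
    qed
    then have "(\<lambda>n. \<Sum>k\<in>UNIV. T \<theta> n k x - (c n)\<^sup>2 * ((A k x *v q k) \<bullet> dflux Y (q k) - \<kappa> * (norm (damp Y (q k)))\<^sup>2))
      \<longlonglongrightarrow> (\<Sum>k\<in>(UNIV::'n set). 0)"
      by (rule tendsto_sum)
    moreover have "(\<Sum>k\<in>UNIV. (A k x *v q k) \<bullet> dflux Y (q k) - \<kappa> * (norm (damp Y (q k)))\<^sup>2) = (\<psi> x)\<^sup>2 * F x"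
    proof -
      have "(A k x *v q k) \<bullet> dflux Y (q k) - \<kappa> * (norm (damp Y (q k)))\<^sup>2 = (if k = h then (\<psi> x)\<^sup>2 * F x else 0)" for k
        unfolding q_def dflux_def damp_def F_def
        by (auto simp: linear_scale[OF linear_dradial] linear_0[OF linear_dradial]
            matrix_vector_mult_scaleR_complex power_mult_distrib power2_eq_square algebra_simps)
      then show ?thesis by simp
    qed
    ultimately show ?thesis
      by (simp add: sum_subtractf c_def flip: sum_distrib_left)
  qed

  \<comment> \<open>The phases \<open>0\<close> and \<open>pi / 2\<close> together contribute \<open>cos\<^sup>2 + sin\<^sup>2 = 1\<close>, so \<open>H\<close> converges
    although the two summands do not.\<close>
  define H where "H n x = (G 0 n x + G (pi / 2) n x) / (N n)\<^sup>2" for n x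
  have H_int: "integrable lebesgue (H n)" for n
    unfolding H_def using G_int by (intro integrable_divide Bochner_Integration.integrable_add)
  have H_nonneg: "0 \<le> (\<integral>x. H n x \<partial>lebesgue)" for n
  proof -
    have "(\<integral>x. H n x \<partial>lebesgue) = ((\<integral>x. G 0 n x \<partial>lebesgue) + (\<integral>x. G (pi / 2) n x \<partial>lebesgue)) / (N n)\<^sup>2"
      unfolding H_def by (simp add: G_int)
    then show ?thesis using G_nonneg by simp
  qed
  have H_lim: "(\<lambda>n. H n x) \<longlonglongrightarrow> indicator \<Omega> x * ((\<psi> x)\<^sup>2 * F x)" for x
  proof (cases "x \<in> K")
    case True
    have H: "H n x = (\<Sum>k\<in>UNIV. T 0 n k x) + (\<Sum>k\<in>UNIV. T (pi / 2) n k x)" for n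
      using Npos[of n] by (simp add: H_def G_on[OF True] add_divide_distrib)
    have cc: "(cos ((N n)\<^sup>2 * (x $ h) + 0))\<^sup>2 + (cos ((N n)\<^sup>2 * (x $ h) + pi / 2))\<^sup>2 = 1" for n
      by (simp add: cos_add)
    have "(\<lambda>n. H n x - ((cos ((N n)\<^sup>2 * (x $ h) + 0))\<^sup>2 + (cos ((N n)\<^sup>2 * (x $ h) + pi / 2))\<^sup>2)
      * ((\<psi> x)\<^sup>2 * F x)) \<longlonglongrightarrow> 0 + 0"
      using tendsto_add[OF T_lim[OF True, of 0] T_lim[OF True, of "pi / 2"]]
      unfolding H by (simp only: algebra_simps)
    then have "(\<lambda>n. H n x - (\<psi> x)\<^sup>2 * F x) \<longlonglongrightarrow> 0"
      unfolding cc by simp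
    then show ?thesis using True K by (auto simp: LIM_zero_iff)
  next
    case False
    have "(\<lambda>n. (2 * (indicator \<Omega> x * dissipation_gap A \<kappa> u0 w0 v0 x)) * (inverse (N n) * inverse (N n)))
      \<longlonglongrightarrow> (2 * (indicator \<Omega> x * dissipation_gap A \<kappa> u0 w0 v0 x)) * (0 * 0)"
      by (intro tendsto_intros Nlim)
    moreover have "H n x = (2 * (indicator \<Omega> x * dissipation_gap A \<kappa> u0 w0 v0 x)) * (inverse (N n) * inverse (N n))" for n
    proof -
      have "x \<in> - K" using False by simp
      then show ?thesis
        by (simp only: H_def G_off mult_2) (simp only: divide_inverse power2_eq_square inverse_mult_distrib)
    qed
    ultimately show ?thesis using \<psi>(4)[OF False] by simp
  qed

  \<comment> \<open>Construction of the dominating function. On K, b bounds P independently of the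
    frequency and the phase; \<open>C2\<close> and \<open>C3\<close> then bound \<open>dflux\<close>
    and \<open>damp\<close> over the annulus. Only the entries of A remain unbounded, and they are
    integrable on K.\<close>
  define b where "b x = (\<Sum>k\<in>UNIV. \<bar>partial_deriv k s x\<bar> + \<bar>partial_deriv k \<psi> x\<bar> * norm \<zeta>) + norm \<zeta>" for x
  have "continuous_on K b"
    unfolding b_def
    by (intro continuous_intros continuous_on_subset[OF C1_onD(3)[OF s(2)]]
        continuous_on_subset[OF C1_onD(3)[OF \<psi>(1)]]) auto
  then have "bounded (b ` K)" by (intro compact_imp_bounded compact_continuous_image K)
  then obtain B where B: "B > 0" "\<And>x. x \<in> K \<Longrightarrow> norm (b x) \<le> B" by (auto simp: bounded_pos)
  have P_bound: "norm (P \<theta> n k x) \<le> B" if x: "x \<in> K" for \<theta> n k x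
  proof -
    have iN: "0 \<le> inverse (N n)" "inverse (N n) \<le> 1" using N1[of n] Npos[of n] by (auto simp: divide_simps)
    have "norm (P \<theta> n k x) \<le> norm ((inverse (N n) * partial_deriv k s x) *\<^sub>R \<omega>)
      + norm ((partial_deriv k \<psi> x * (sin ((N n)\<^sup>2 * (x $ h) + \<theta>) * inverse (N n) * inverse (N n))) *\<^sub>R \<zeta>)
      + norm (cos ((N n)\<^sup>2 * (x $ h) + \<theta>) *\<^sub>R (if k = h then \<psi> x *\<^sub>R \<zeta> else 0))"
      unfolding P_def by (intro order_trans[OF norm_triangle_ineq] add_right_mono) simp
    also have "\<dots> \<le> \<bar>partial_deriv k s x\<bar> + \<bar>partial_deriv k \<psi> x\<bar> * norm \<zeta> + norm \<zeta>"
    proof (intro add_mono)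
      show "norm ((inverse (N n) * partial_deriv k s x) *\<^sub>R \<omega>) \<le> \<bar>partial_deriv k s x\<bar>"
        using iN \<omega> by (simp only: norm_scaleR abs_mult) (simp add: mult_left_le_one_le)
      have "\<bar>sin ((N n)\<^sup>2 * (x $ h) + \<theta>) * inverse (N n) * inverse (N n)\<bar> \<le> 1"
        unfolding abs_mult using iN by (intro mult_le_one) auto
      then show "norm ((partial_deriv k \<psi> x * (sin ((N n)\<^sup>2 * (x $ h) + \<theta>) * inverse (N n) * inverse (N n))) *\<^sub>R \<zeta>)
        \<le> \<bar>partial_deriv k \<psi> x\<bar> * norm \<zeta>"
        unfolding norm_scaleR abs_mult[of "partial_deriv k \<psi> x"]
        by (intro mult_right_mono mult_right_le_one_le) auto
      show "norm (cos ((N n)\<^sup>2 * (x $ h) + \<theta>) *\<^sub>R (if k = h then \<psi> x *\<^sub>R \<zeta> else 0)) \<le> norm \<zeta>"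
        using \<psi>(2,3)[of x]
        by (auto simp: mult.assoc[symmetric] intro!: mult_left_le_one_le mult_le_one)
    qed
    also have "\<dots> \<le> b x"
    proof -
      have "\<bar>partial_deriv k s x\<bar> + \<bar>partial_deriv k \<psi> x\<bar> * norm \<zeta>
        \<le> (\<Sum>k\<in>UNIV. \<bar>partial_deriv k s x\<bar> + \<bar>partial_deriv k \<psi> x\<bar> * norm \<zeta>)"
        by (rule member_le_sum) auto
      then show ?thesis by (simp add: b_def)
    qed
    finally show ?thesis using B(2)[OF x] by simp
  qed
  obtain C2 where C2: "C2 \<ge> 0" "\<And>y d :: complex ^ 'm. S / 2 \<le> norm y \<Longrightarrow> norm y \<le> 3 * S / 2 \<Longrightarrow> norm d \<le> B \<Longrightarrow>
      norm (dflux y d) \<le> C2"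
    using dradial_bounded[OF continuous_phi continuous_logder, of "S / 2" "3 * S / 2" B] S
    unfolding dflux_def by auto
  obtain C3 where C3: "C3 \<ge> 0" "\<And>y d :: complex ^ 'm. S / 2 \<le> norm y \<Longrightarrow> norm y \<le> 3 * S / 2 \<Longrightarrow> norm d \<le> B \<Longrightarrow>
      norm (damp y d) \<le> C3"
    using dradial_bounded[OF continuous_sqrt_phi continuous_half_logder, of "S / 2" "3 * S / 2" B] S
    unfolding damp_def by auto
  define R where "R x = (\<Sum>k\<in>UNIV. (\<Sum>i\<in>UNIV. \<Sum>j\<in>UNIV. norm (A k x $ i $ j)) * (B * C2) + \<kappa> * C3\<^sup>2)" for x
  have T_bound: "\<bar>\<Sum>k\<in>UNIV. T \<theta> n k x\<bar> \<le> R x" if x: "x \<in> K" for \<theta> n x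
    unfolding R_def
  proof (rule order_trans[OF sum_abs sum_mono])
    fix k
    define a where "a = (\<Sum>i\<in>UNIV. \<Sum>j\<in>UNIV. norm (A k x $ i $ j))"
    have a: "a \<ge> 0" by (simp add: a_def sum_nonneg)
    have p: "norm (dflux (u \<theta> n x) (P \<theta> n k x)) \<le> C2" "norm (damp (u \<theta> n x) (P \<theta> n k x)) \<le> C3"
      using C2(2) C3(2) annulus[OF x] P_bound[OF x] by blast+
    have "norm (A k x *v P \<theta> n k x) \<le> a * B"
      using norm_matrix_vector_mult_le[of "A k x" "P \<theta> n k x"] mult_left_mono[OF P_bound[OF x] a]
      unfolding a_def by (meson order_trans)
    then have "\<bar>(A k x *v P \<theta> n k x) \<bullet> dflux (u \<theta> n x) (P \<theta> n k x)\<bar> \<le> (a * B) * C2"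
      using p(1) a B by (intro order_trans[OF Cauchy_Schwarz_ineq2] mult_mono) auto
    moreover have "\<kappa> * (norm (damp (u \<theta> n x) (P \<theta> n k x)))\<^sup>2 \<le> \<kappa> * C3\<^sup>2"
      using p(2) \<kappa> by (intro mult_left_mono power_mono) auto
    moreover have "0 \<le> \<kappa> * (norm (damp (u \<theta> n x) (P \<theta> n k x)))\<^sup>2" using \<kappa> by simp
    ultimately show "\<bar>T \<theta> n k x\<bar> \<le> (\<Sum>i\<in>UNIV. \<Sum>j\<in>UNIV. norm (A k x $ i $ j)) * (B * C2) + \<kappa> * C3\<^sup>2"
      unfolding T_def a_def[symmetric] by (simp add: abs_le_iff algebra_simps)
  qed
  \<comment> \<open>The factors 2 account for the two phases. Off K the estimate uses N \<ge> 1, so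
    that dividing by its square does not increase the gap of the unperturbed profile.\<close>
  define W where "W x = 2 * \<bar>indicator \<Omega> x * dissipation_gap A \<kappa> u0 w0 v0 x\<bar> + 2 * (indicator K x * R x)" for x
  have "integrable lebesgue (\<lambda>x. indicator K x * R x)"
  proof -
    have 1: "integrable lebesgue (\<lambda>x. indicator K x * norm (A k x $ i $ j))" for k i j
    proof -
      have "integrable lebesgue (\<lambda>x. indicator K x *\<^sub>R A k x $ i $ j)"
        using A[of k i j] K by (simp add: L1_loc_def set_integrable_def)
      from integrable_norm[OF this] show ?thesis by simp
    qed
    have 2: "integrable lebesgue (\<lambda>x. indicator K x :: real)"
      using lmeasurable_compact[OF K(1)] by (intro integrable_real_indicator) (auto simp: fmeasurable_def)
    have eq: "indicator K x * R x = (\<Sum>k\<in>UNIV. (\<Sum>i\<in>UNIV. \<Sum>j\<in>UNIV. indicator K x * norm (A k x $ i $ j)) * (B * C2)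
      + indicator K x * (\<kappa> * C3\<^sup>2))" for x
      unfolding R_def by (simp add: sum_distrib_left sum_distrib_right algebra_simps)
    show ?thesis unfolding eq
      by (intro Bochner_Integration.integrable_sum Bochner_Integration.integrable_add
          integrable_mult_left 1 2)
  qed
  then have W_int: "integrable lebesgue W"
    unfolding W_def using gap_0
    by (intro Bochner_Integration.integrable_add integrable_mult_right integrable_abs)
  have HW: "norm (H n x) \<le> W x" for n x
  proof (cases "x \<in> K")
    case True
    have "H n x = (\<Sum>k\<in>UNIV. T 0 n k x) + (\<Sum>k\<in>UNIV. T (pi / 2) n k x)"
      using Npos[of n] by (simp add: H_def G_on[OF True] add_divide_distrib)
    then show ?thesis
      using T_bound[OF True, of 0 n] T_bound[OF True, of "pi / 2" n] True by (simp add: W_def)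
  next
    case False
    define g where "g = \<bar>indicator \<Omega> x * dissipation_gap A \<kappa> u0 w0 v0 x\<bar>"
    have "norm (H n x) = 2 * g / (N n)\<^sup>2"
      using False by (simp add: H_def G_off g_def abs_mult)
    also have "\<dots> \<le> 2 * g / 1"
      using N1[of n] by (intro divide_left_mono) (auto simp: g_def)
    finally show ?thesis using False by (simp add: W_def g_def)
  qed
  have "(\<lambda>n. \<integral>x. H n x \<partial>lebesgue) \<longlonglongrightarrow> (\<integral>x. indicator \<Omega> x * ((\<psi> x)\<^sup>2 * F x) \<partial>lebesgue)"
  proof (rule integral_dominated_convergence[where w = W])
    show "(\<lambda>x. indicator \<Omega> x * ((\<psi> x)\<^sup>2 * F x)) \<in> borel_measurable lebesgue"
      by (rule borel_measurable_LIMSEQ_real[OF H_lim borel_measurable_integrable[OF H_int]])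
    show "H n \<in> borel_measurable lebesgue" for n by (rule borel_measurable_integrable[OF H_int])
  qed (use W_int H_lim HW in auto)
  then have "0 \<le> (\<integral>x. indicator \<Omega> x * ((\<psi> x)\<^sup>2 * F x) \<partial>lebesgue)"
    by (rule LIMSEQ_le_const) (use H_nonneg in blast)
  then show ?thesis by (simp add: F_def)
qed

end

subsection \<open>Necessity\<close>

text \<open>If the set E of negative values inside a compact set had positive measure, inner
  regularity would give a closed T in E with E - T of smaller measure than E. The nonnegative
  integral of F over T forces T to be null, since F is negative there, so E - T would have the full
  measure of E. Countably many compact boxes exhaust \<Omega>.\<close>

lemma AE_nonneg_if_compact_integrals_nonneg:
  fixes F :: "real ^ 'n \<Rightarrow> real"
  assumes "open \<Omega>"
    and int: "\<And>K. compact K \<Longrightarrow> K \<subseteq> \<Omega> \<Longrightarrow> integrable lebesgue (\<lambda>x. indicator K x * F x)"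
    and nonneg: "\<And>K. compact K \<Longrightarrow> K \<subseteq> \<Omega> \<Longrightarrow> 0 \<le> (\<integral>x. indicator K x * F x \<partial>lebesgue)"
  shows "AE x\<in>\<Omega> in lebesgue. 0 \<le> F x"
proof -
  have neg: "negligible {x\<in>C. F x < 0}" if C: "compact C" "C \<subseteq> \<Omega>" for C
  proof -
    define E where "E = {x\<in>C. F x < 0}"
    have "E = (\<lambda>x. indicator C x * F x) -` {..<0} \<inter> space lebesgue"
    proof (rule set_eqI)
      show "x \<in> E \<longleftrightarrow> x \<in> (\<lambda>x. indicator C x * F x) -` {..<0} \<inter> space lebesgue" for x
        by (cases "x \<in> C") (simp_all add: E_def)
    qed
    also have "\<dots> \<in> sets lebesgue"
      by (rule measurable_sets[OF borel_measurable_integrable[OF int[OF C]]]) simp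
    finally have E: "E \<in> sets lebesgue" .
    have bE: "bounded E" using C(1) by (rule bounded_subset[OF compact_imp_bounded]) (auto simp: E_def)
    then have lE: "E \<in> lmeasurable" using E by (rule bounded_set_imp_lmeasurable)
    have "measure lebesgue E = 0"
    proof (rule ccontr)
      assume "measure lebesgue E \<noteq> 0"
      then have "measure lebesgue E > 0" by (simp add: less_le)
      then obtain T where T: "closed T" "T \<subseteq> E" "emeasure lebesgue (E - T) < ennreal (measure lebesgue E)"
        using sets_lebesgue_inner_closed[OF E] by metis
      have cT: "compact T" "T \<subseteq> \<Omega>"
        using T bE bounded_subset C(2) by (auto simp: compact_eq_bounded_closed E_def)
      have le: "indicator T x * F x \<le> 0" for x using T(2) by (auto simp: indicator_def E_def)
      have "integrable lebesgue (\<lambda>x. - (indicator T x * F x))" using int[OF cT] by simp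
      moreover have "AE x in lebesgue. 0 \<le> - (indicator T x * F x)" using le by simp
      moreover have "(\<integral>x. - (indicator T x * F x) \<partial>lebesgue) = 0"
        using nonneg[OF cT] integral_nonneg_AE[OF calculation(2)] by simp
      ultimately have "AE x in lebesgue. - (indicator T x * F x) = 0"
        using integral_nonneg_eq_0_iff_AE by blast
      then have "AE x in lebesgue. x \<notin> T"
        by eventually_elim (use T(2) in \<open>auto simp: indicator_def E_def split: if_splits\<close>)
      then have "T \<in> null_sets lebesgue"
        using T(1) by (subst AE_iff_null_sets) auto
      then have "emeasure lebesgue (E - T) = emeasure lebesgue E"
        by (rule emeasure_Diff_null_set[OF _ E])
      then show False using T(3) emeasure_eq_measure2[OF lE] by simp
    qed
    then show ?thesis using lE unfolding E_def negligible_iff_measure by blast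
  qed
  obtain \<D> where D: "countable \<D>" "\<D> \<subseteq> Pow \<Omega>" "\<And>X. X \<in> \<D> \<Longrightarrow> \<exists>a b. X = cbox a b" "\<Union>\<D> = \<Omega>"
    using open_countable_Union_open_cbox[OF assms(1)] by metis
  have "AE x in lebesgue. \<forall>C\<in>\<D>. x \<in> C \<longrightarrow> 0 \<le> F x"
    unfolding AE_ball_countable[OF D(1)]
  proof
    fix C assume C: "C \<in> \<D>"
    then have "compact C" "C \<subseteq> \<Omega>" using D(2) D(3)[OF C] compact_cbox by auto
    from neg[OF this] have "{x\<in>C. F x < 0} \<in> null_sets lebesgue"
      by (simp add: negligible_iff_null_sets)
    from AE_not_in[OF this] show "AE x in lebesgue. x \<in> C \<longrightarrow> 0 \<le> F x"
      by eventually_elim auto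
  qed
  then show ?thesis by eventually_elim (use D(4) in blast)
qed

context phi_function
begin

text \<open>The weights in \<open>oscillation_inequality\<close> are squares of C^1 bumps. Bumps
  equal to 1 on K with supports shrinking to K converge pointwise to the indicator of K, and
  dominated convergence gives the claim.\<close>

lemma compact_integral_nonneg:
  fixes A :: "'n \<Rightarrow> real ^ 'n \<Rightarrow> complex ^ 'm ^ 'm"
  assumes \<Omega>: "open \<Omega>" and A: "\<And>h i j. (\<lambda>x. A h x $ i $ j) \<in> L1_loc \<Omega>"
    and diss: "\<And>u. u \<in> C1_0_vec \<Omega> \<Longrightarrow> (\<lambda>x. \<phi> (norm (u x)) *\<^sub>R u x) \<in> C1_0_vec \<Omega> \<Longrightarrow>
      \<kappa> * (LINT x:\<Omega>|lebesgue. \<Sum>h\<in>UNIV. (norm (partial_deriv h (\<lambda>y. sqrt (\<phi> (norm (u y))) *\<^sub>R u y) x))\<^sup>2)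
      \<le> Re (LINT x:\<Omega>|lebesgue. \<Sum>h\<in>UNIV. herm_inner (A h x *v partial_deriv h u x)
          (partial_deriv h (\<lambda>y. \<phi> (norm (u y)) *\<^sub>R u y) x))"
    and \<kappa>: "\<kappa> \<ge> 0" and Y: "Y \<noteq> 0" and K: "compact K" "K \<subseteq> \<Omega>"
  shows "integrable lebesgue (\<lambda>x. indicator K x * ((A h x *v \<zeta>) \<bullet> dflux Y \<zeta> - \<kappa> * (norm (damp Y \<zeta>))\<^sup>2))"
    and "0 \<le> (\<integral>x. indicator K x * ((A h x *v \<zeta>) \<bullet> dflux Y \<zeta> - \<kappa> * (norm (damp Y \<zeta>))\<^sup>2) \<partial>lebesgue)"
proof -
  define F where "F x = (A h x *v \<zeta>) \<bullet> dflux Y \<zeta> - \<kappa> * (norm (damp Y \<zeta>))\<^sup>2" for x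
  have F_int: "integrable lebesgue (\<lambda>x. indicator K x * F x)" if K: "compact K" "K \<subseteq> \<Omega>" for K
  proof -
    have "(\<lambda>x. A h x $ i $ j) \<in> L1_loc K" for i j
      using A[of h i j] K(2) by (auto simp: L1_loc_def)
    then have "set_integrable lebesgue K (\<lambda>x. herm_inner (A h x *v \<zeta>) (dflux Y \<zeta>))"
      by (rule set_integrable_herm_inner[OF _ K(1)]) (auto intro: continuous_intros)
    then have 1: "integrable lebesgue (\<lambda>x. Re (indicator K x *\<^sub>R herm_inner (A h x *v \<zeta>) (dflux Y \<zeta>)))"
      unfolding set_integrable_def by (rule integrable_Re)
    have 2: "integrable lebesgue (\<lambda>x. indicator K x :: real)"
      using lmeasurable_compact[OF K(1)] by (intro integrable_real_indicator) (auto simp: fmeasurable_def)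
    have eq: "indicator K x * F x = Re (indicator K x *\<^sub>R herm_inner (A h x *v \<zeta>) (dflux Y \<zeta>))
      - indicator K x * (\<kappa> * (norm (damp Y \<zeta>))\<^sup>2)" for x
      by (simp add: F_def Re_herm_inner algebra_simps)
    show ?thesis unfolding eq by (intro Bochner_Integration.integrable_diff 1 integrable_mult_left 2)
  qed
  then show "integrable lebesgue (\<lambda>x. indicator K x * ((A h x *v \<zeta>) \<bullet> dflux Y \<zeta> - \<kappa> * (norm (damp Y \<zeta>))\<^sup>2))"
    using K by (simp add: F_def)
  have "0 \<le> (\<integral>x. indicator K x * F x \<partial>lebesgue)"
  \<comment> \<open>The empty set is treated separately because \<open>infdist\<close> to it is 0 by
    convention, so distances could not separate points from it.\<close>
  proof (cases "K = {}")
    case False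
    obtain \<eta> K1 where \<eta>: "C1_on UNIV \<eta>" "\<And>x. x \<in> K \<Longrightarrow> \<eta> x = 1" "compact K1" "K1 \<subseteq> \<Omega>"
      "\<And>x. x \<notin> K1 \<Longrightarrow> \<eta> x = (0::real)"
      using C1_bump[OF \<Omega> K] by metis
    \<comment> \<open>The distance condition shrinks the neighbourhoods to K, while positivity of
      \<eta> keeps all of them inside the fixed compact set \<open>K1\<close>, over which |F| is
      integrable.\<close>
    define V where "V j = {x. infdist x K < inverse (real (Suc j))} \<inter> {x. 0 < \<eta> x}" for j
    have V: "open (V j)" for j
      unfolding V_def
      by (intro open_Int open_Collect_less continuous_intros C1_on_imp_continuous_on[OF \<eta>(1)])
    have KV: "K \<subseteq> V j" for j by (auto simp: V_def \<eta>(2))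
    have V1: "V j \<subseteq> K1" for j using \<eta>(5) by (force simp: V_def)
    have "\<exists>\<psi> K'. C1_on UNIV \<psi> \<and> (\<forall>x. 0 \<le> \<psi> x) \<and> (\<forall>x. \<psi> x \<le> 1) \<and> (\<forall>x\<in>K. \<psi> x = 1) \<and>
      compact K' \<and> K' \<subseteq> V j \<and> (\<forall>x. x \<notin> K' \<longrightarrow> \<psi> x = (0::real))" for j
      by (rule C1_bump[OF V[of j] K(1) KV[of j]]) blast
    then obtain \<psi> K' where \<psi>: "\<And>j. C1_on UNIV (\<psi> j)" "\<And>j x. 0 \<le> \<psi> j x" "\<And>j x. \<psi> j x \<le> 1"
      "\<And>j x. x \<in> K \<Longrightarrow> \<psi> j x = 1" "\<And>j. compact (K' j)" "\<And>j. K' j \<subseteq> V j"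
      "\<And>j x. x \<notin> K' j \<Longrightarrow> \<psi> j x = (0::real)"
      by metis
    have ge: "0 \<le> (\<integral>x. indicator \<Omega> x * ((\<psi> j x)\<^sup>2 * F x) \<partial>lebesgue)" for j
    proof -
      have "K' j \<subseteq> \<Omega>" using \<psi>(6)[of j] V1[of j] \<eta>(4) by blast
      from oscillation_inequality[OF \<Omega> A diss \<kappa> \<psi>(5) this \<psi>(1-3) \<psi>(7) Y, of j h \<zeta>]
      show ?thesis by (simp add: F_def)
    qed
    have zero: "\<psi> j x = 0" if "x \<notin> K1" for j x
      using \<psi>(6)[of j] V1[of j] that by (intro \<psi>(7)) blast
    have lim: "(\<lambda>j. indicator \<Omega> x * ((\<psi> j x)\<^sup>2 * F x)) \<longlonglongrightarrow> indicator K x * F x" for x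
    proof (cases "x \<in> K")
      case True
      then show ?thesis using K(2) by (auto simp: \<psi>(4))
    next
      case False
      then have "infdist x K > 0"
        using in_closed_iff_infdist_zero[OF compact_imp_closed[OF K(1)] \<open>K \<noteq> {}\<close>, of x]
          infdist_nonneg[of x K] by simp
      then obtain m where m: "inverse (real (Suc m)) < infdist x K"
        using reals_Archimedean by blast
      have "\<psi> j x = 0" if "m \<le> j" for j
      proof -
        have "inverse (real (Suc j)) \<le> inverse (real (Suc m))" using that by (simp add: divide_simps)
        then have "\<not> infdist x K < inverse (real (Suc j))" using m by linarith
        then have "x \<notin> V j" by (simp add: V_def)
        then show ?thesis using \<psi>(6,7) by blast
      qed
      then have "\<forall>\<^sub>F j in sequentially. 0 = indicator \<Omega> x * ((\<psi> j x)\<^sup>2 * F x)"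
        unfolding eventually_sequentially by (intro exI[of _ m]) simp
      from Lim_transform_eventually[OF tendsto_const this] show ?thesis using False by simp
    qed
    have meas: "(\<lambda>x. indicator \<Omega> x * ((\<psi> j x)\<^sup>2 * F x)) \<in> borel_measurable lebesgue" for j
    proof -
      have "\<psi> j \<in> borel_measurable borel"
        using C1_on_imp_continuous_on[OF \<psi>(1)] by (rule borel_measurable_continuous_onI)
      then have "\<psi> j \<in> borel_measurable lebesgue" by (simp add: measurable_completion)
      then have "(\<lambda>x. (\<psi> j x)\<^sup>2 * (indicator K1 x * F x)) \<in> borel_measurable lebesgue"
        using borel_measurable_integrable[OF F_int[OF \<eta>(3,4)]] by measurable
      moreover have "(\<psi> j x)\<^sup>2 * (indicator K1 x * F x) = indicator \<Omega> x * ((\<psi> j x)\<^sup>2 * F x)" for x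
        using zero[of x j] \<eta>(4) by (auto simp: indicator_def)
      ultimately show ?thesis by (simp only:)
    qed
    have "(\<lambda>j. \<integral>x. indicator \<Omega> x * ((\<psi> j x)\<^sup>2 * F x) \<partial>lebesgue) \<longlonglongrightarrow> (\<integral>x. indicator K x * F x \<partial>lebesgue)"
    proof (rule integral_dominated_convergence[where w = "\<lambda>x. \<bar>indicator K1 x * F x\<bar>"])
      show "integrable lebesgue (\<lambda>x. \<bar>indicator K1 x * F x\<bar>)"
        using F_int[OF \<eta>(3,4)] by (rule integrable_abs)
      have "norm (indicator \<Omega> x * ((\<psi> j x)\<^sup>2 * F x)) \<le> \<bar>indicator K1 x * F x\<bar>" for j x
      proof (cases "x \<in> K1")
        case True
        have "(\<psi> j x)\<^sup>2 \<le> 1" using \<psi>(2,3) by (simp add: power_le_one)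
        then have "(\<psi> j x)\<^sup>2 * \<bar>F x\<bar> \<le> 1 * \<bar>F x\<bar>" by (rule mult_right_mono) simp
        then show ?thesis using True \<eta>(4) by (auto simp: abs_mult)
      qed (simp add: zero)
      then show "AE x in lebesgue. norm (indicator \<Omega> x * ((\<psi> j x)\<^sup>2 * F x)) \<le> \<bar>indicator K1 x * F x\<bar>" for j
        by simp
    qed (use lim meas borel_measurable_integrable[OF F_int[OF K]] in auto)
    then show ?thesis by (rule LIMSEQ_le_const) (use ge in blast)
  qed simp
  then show "0 \<le> (\<integral>x. indicator K x * ((A h x *v \<zeta>) \<bullet> dflux Y \<zeta> - \<kappa> * (norm (damp Y \<zeta>))\<^sup>2) \<partial>lebesgue)"
    by (simp add: F_def)
qed

text \<open>The exceptional null set of the integral argument depends on h, Y and d. A countable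
  dense set of pairs (Y, d), combined with the finitely many h, gives one null set for all of them;
  continuity then reaches every pair with Y nonzero, and \<open>form_limit\<close> sends |Y| to
  infinity. The constant \<kappa> is preserved throughout.\<close>

lemma necessity:
  fixes A :: "'n \<Rightarrow> real ^ 'n \<Rightarrow> complex ^ 'm ^ 'm"
  assumes \<Omega>: "open \<Omega>" and A: "\<And>h i j. (\<lambda>x. A h x $ i $ j) \<in> L1_loc \<Omega>"
    and sd: "strict_dissipative \<phi> \<Omega> A"
  shows "\<exists>k>0. AE x\<in>\<Omega> in lebesgue. \<forall>\<xi> \<omega>. norm \<omega> = 1 \<longrightarrow> (\<forall>h.
      k * (norm \<xi>)\<^sup>2 \<le> dissipative_form (A h x) (Lambda_infty \<phi>) \<xi> \<omega>)"
proof -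
  obtain \<kappa> where \<kappa>: "\<kappa> > 0" and diss: "\<And>u. u \<in> C1_0_vec \<Omega> \<Longrightarrow> (\<lambda>x. \<phi> (norm (u x)) *\<^sub>R u x) \<in> C1_0_vec \<Omega> \<Longrightarrow>
      \<kappa> * (LINT x:\<Omega>|lebesgue. \<Sum>h\<in>UNIV. (norm (partial_deriv h (\<lambda>y. sqrt (\<phi> (norm (u y))) *\<^sub>R u y) x))\<^sup>2)
      \<le> Re (LINT x:\<Omega>|lebesgue. \<Sum>h\<in>UNIV. herm_inner (A h x *v partial_deriv h u x)
          (partial_deriv h (\<lambda>y. \<phi> (norm (u y)) *\<^sub>R u y) x))"
    using sd unfolding strict_dissipative_def by blast
  define f where "f M z = (M *v snd z) \<bullet> dflux (fst z) (snd z) - \<kappa> * (norm (damp (fst z) (snd z)))\<^sup>2"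
    for M :: "complex ^ 'm ^ 'm" and z
  obtain D :: "(complex ^ 'm) set" where D: "countable D" "\<And>X. open X \<Longrightarrow> X \<noteq> {} \<Longrightarrow> \<exists>d\<in>D. d \<in> X"
    using countable_dense_exists by blast
  define I where "I = (UNIV :: 'n set) \<times> ((D - {0}) \<times> D)"
  have cI: "countable I" unfolding I_def using D(1) by (intro countable_SIGMA countable_Diff) (auto intro: countable_finite)
  have "AE x in lebesgue. \<forall>i\<in>I. x \<in> \<Omega> \<longrightarrow> 0 \<le> f (A (fst i) x) (snd i)"
    unfolding AE_ball_countable[OF cI]
  proof
    fix i assume "i \<in> I"
    then have Y: "fst (snd i) \<noteq> 0" by (auto simp: I_def)
    show "AE x in lebesgue. x \<in> \<Omega> \<longrightarrow> 0 \<le> f (A (fst i) x) (snd i)"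
      unfolding f_def
      by (rule AE_nonneg_if_compact_integrals_nonneg[OF \<Omega>])
        (rule compact_integral_nonneg[OF \<Omega> A diss _ Y]; use \<kappa> in simp)+
  qed
  then have "AE x\<in>\<Omega> in lebesgue. \<forall>\<xi> \<omega>. norm \<omega> = 1 \<longrightarrow> (\<forall>h.
      \<kappa> * (norm \<xi>)\<^sup>2 \<le> dissipative_form (A h x) (Lambda_infty \<phi>) \<xi> \<omega>)"
  proof eventually_elim
    case (elim x)
    show ?case
    proof (intro impI allI)
      fix \<xi> \<omega> :: "complex ^ 'm" and h :: 'n
      assume x: "x \<in> \<Omega>" and w: "norm \<omega> = 1"
      define S where "S = (- {0 :: complex ^ 'm}) \<times> (UNIV :: (complex ^ 'm) set)"
      have S: "open S" unfolding S_def by (intro open_Times) auto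
      have "continuous_on S (\<lambda>z. dflux (fst z) (snd z))" "continuous_on S (\<lambda>z. damp (fst z) (snd z))"
        unfolding dflux_def damp_def
        by (intro continuous_on_dradial continuous_phi continuous_logder continuous_sqrt_phi
            continuous_half_logder continuous_intros; force simp: S_def)+
      moreover have "continuous_on S (\<lambda>z. A h x *v snd z)"
        by (intro bounded_linear.continuous_on[OF bounded_linear_matrix_vector_mult_complex] continuous_intros)
      ultimately have "continuous_on S (f (A h x))"
        unfolding f_def[abs_def] by (intro continuous_intros)
      then have U: "open (S \<inter> f (A h x) -` {..<0})"
        using S by (intro continuous_open_preimage) auto
      have "\<kappa> * (norm (damp Y d))\<^sup>2 \<le> (A h x *v d) \<bullet> dflux Y d" if "Y \<noteq> 0" for Y d
      \<comment> \<open>By continuity a violating pair has a product neighbourhood of violating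
        pairs, which contains one from the dense set. That pair has first component nonzero because
        the neighbourhood lies in S, so it belongs to the index set I.\<close>
      proof (rule ccontr)
        assume "\<not> ?thesis"
        then have "(Y, d) \<in> S \<inter> f (A h x) -` {..<0}" using that by (simp add: S_def f_def)
        then obtain P Q where PQ: "open P" "open Q" "Y \<in> P" "d \<in> Q" "P \<times> Q \<subseteq> S \<inter> f (A h x) -` {..<0}"
          using open_prod_elim[OF U] by (metis mem_Sigma_iff)
        obtain a b where ab: "a \<in> D" "a \<in> P" "b \<in> D" "b \<in> Q"
          using D(2)[OF PQ(1)] D(2)[OF PQ(2)] PQ(3,4) by blast
        then have "(a, b) \<in> S \<inter> f (A h x) -` {..<0}" using PQ(5) by blast
        then have "(h, a, b) \<in> I" "f (A h x) (a, b) < 0" using ab by (auto simp: I_def S_def)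
        then show False using elim x by force
      qed
      then show "\<kappa> * (norm \<xi>)\<^sup>2 \<le> dissipative_form (A h x) (Lambda_infty \<phi>) \<xi> \<omega>"
        by (rule form_limit[OF _ w])
    qed
  qed
  then show ?thesis using \<kappa> by blast
qed

end

theorem theorem4:
  fixes \<phi> :: "real \<Rightarrow> real"
    and \<Omega> :: "(real ^ 'n) set"
    and A :: "'n \<Rightarrow> real ^ 'n \<Rightarrow> complex ^ 'm ^ 'm"
  assumes "phi_conditions \<phi>"
    and "open \<Omega>" and "connected \<Omega>" and "\<Omega> \<noteq> {}"
    and "\<And>h i j. (\<lambda>x. A h x $ i $ j) \<in> L1_loc \<Omega>"
    and "(Lambda_infty \<phi>)\<^sup>2 < 1"
  shows "strict_dissipative \<phi> \<Omega> A \<longleftrightarrow>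
    (\<exists>\<kappa>'>0. AE x\<in>\<Omega> in lebesgue. \<forall>\<xi> \<omega> :: complex ^ 'm. norm \<omega> = 1 \<longrightarrow> (\<forall>h.
       Re (herm_inner (A h x *v \<xi>) \<xi>)
       - (Lambda_infty \<phi>)\<^sup>2 * Re (herm_inner (A h x *v \<omega>) \<omega>) * (Re (herm_inner \<xi> \<omega>))\<^sup>2
       + Lambda_infty \<phi> * Re (herm_inner (A h x *v \<omega>) \<xi> - herm_inner (A h x *v \<xi>) \<omega>)
           * Re (herm_inner \<xi> \<omega>)
       \<ge> \<kappa>' * (norm \<xi>)\<^sup>2))"
proof -
  interpret phi_function \<phi> by unfold_locales (rule assms(1))
  have form: "Re (herm_inner (A h x *v \<xi>) \<xi>)
       - (Lambda_infty \<phi>)\<^sup>2 * Re (herm_inner (A h x *v \<omega>) \<omega>) * (Re (herm_inner \<xi> \<omega>))\<^sup>2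
       + Lambda_infty \<phi> * Re (herm_inner (A h x *v \<omega>) \<xi> - herm_inner (A h x *v \<xi>) \<omega>)
           * Re (herm_inner \<xi> \<omega>) = dissipative_form (A h x) (Lambda_infty \<phi>) \<xi> \<omega>" for h x \<xi> \<omega>
    by (simp add: dissipative_form_def dissipative_form_expand Re_herm_inner)
  show ?thesis
    unfolding form
    using sufficiency[where A = A, OF assms(2,5)] necessity[where A = A, OF assms(2,5)] by blast
qed

end
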